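(* Let $G=\langle V,E_T,E_B,\iota_T,\iota_B,m,Obs,F\rangle$ be a sabotage game with reachability objective for the traveler, finite budget $m\in\mathbb{N}$, and $Obs(v)=V$ for all $v\in V$; let $n=|V|$. If the saboteur has a winning strategy in $G$, then one can be computed in time polynomial in $n$ and exponential in $m$ (namely $n^{O(m)}$).
   Context: A sabotage game is a tuple $G=\langle V,E_T,E_B,\iota_T,\iota_B,m,Obs,F\rangle$ where $V$ is a finite set of vertices; $E_T,E_B\subseteq V\times V$ are the directed edge sets of the traveler and of the saboteur; $\iota_T,\iota_B\in V$ are their initial positions; $m\in\mathbb{N}\cup\{\infty\}$ is the saboteur's budget; $Obs\colon V\to 2^V$ is the traveler's observation function; and $F\subseteq V$ is the set of final vertices. A configuration is a triple $(t,b,T)$ with $t,b\in V$, $T\subseteq V$. A play is a sequence of configurations $C_i=(t^i,b^i,T^i)$ with $C_1=(\iota_T,\iota_B,\emptyset)$, $(t^i,t^{i+1})\in E_T$, $(b^i,b^{i+1})\in E_B$, $T^i\subseteq T^{i+1}\subseteq T^i\cup\{b^i,b^{i+1}\}$ and $|T^{i}|\le m$. The players alternate, the traveler first: the traveler moves along an $E_T$-edge, then the saboteur moves along an $E_B$-edge and may mark (delete) the vertex she left or entered, if not occupied by the traveler and within budget. The traveler loses when it occupies a marked vertex. The traveler observes the marked vertices in $Obs(u)$ for her current vertex $u$ (here all of them). The traveler wins a play if she reaches a vertex of $F$ without having occupied a marked vertex; otherwise the saboteur wins. A strategy for the saboteur is winning if every play agreeing with it is won by the saboteur. *)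

theory Defs
  imports "HOL-Library.Extended_Nat"
begin

section \<open>Sabotage games\<close>

record 'v sabotage_game =
  verts :: "'v set"
  edges_T :: "('v \<times> 'v) set"
  edges_B :: "('v \<times> 'v) set"
  init_T :: 'v
  init_B :: 'v
  budget :: enat
  obs :: "'v \<Rightarrow> 'v set"
  final :: "'v set"

definition valid_game :: "'v sabotage_game \<Rightarrow> bool" where
  "valid_game G \<longleftrightarrow>
     finite (verts G) \<and>
     edges_T G \<subseteq> verts G \<times> verts G \<and>
     edges_B G \<subseteq> verts G \<times> verts G \<and>
     init_T G \<in> verts G \<and> init_B G \<in> verts G \<and>
     (\<forall>v\<in>verts G. obs G v \<subseteq> verts G) \<and>
     final G \<subseteq> verts G"

type_synonym 'v config = "'v \<times> 'v \<times> 'v set"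

definition tpos :: "'v config \<Rightarrow> 'v" where "tpos c = fst c"
definition bpos :: "'v config \<Rightarrow> 'v" where "bpos c = fst (snd c)"
definition marked :: "'v config \<Rightarrow> 'v set" where "marked c = snd (snd c)"

text \<open>In configuration \<open>c\<close> the traveler has just moved to \<open>t'\<close>; the saboteur replies by moving to
  \<open>b'\<close> and changing the marked set to \<open>T'\<close>.  A newly marked vertex must not be \<open>t'\<close>.\<close>

definition saboteur_move ::
    "'v sabotage_game \<Rightarrow> 'v config \<Rightarrow> 'v \<Rightarrow> 'v \<times> 'v set \<Rightarrow> bool" where
  "saboteur_move G c t' = (\<lambda>(b', T').
     (bpos c, b') \<in> edges_B G \<and>
     marked c \<subseteq> T' \<and> T' \<subseteq> marked c \<union> {bpos c, b'} \<and>
     t' \<notin> T' - marked c \<and>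
     enat (card T') \<le> budget G)"

text \<open>A play is a nonempty sequence \<open>C 0, C 1, \<dots>\<close> of \<open>N\<close> configurations, finite or infinite.\<close>

definition is_play :: "'v sabotage_game \<Rightarrow> enat \<Rightarrow> (nat \<Rightarrow> 'v config) \<Rightarrow> bool" where
  "is_play G N C \<longleftrightarrow>
     0 < N \<and> C 0 = (init_T G, init_B G, {}) \<and>
     (\<forall>i. enat (Suc i) < N \<longrightarrow>
        (tpos (C i), tpos (C (Suc i))) \<in> edges_T G \<and>
        saboteur_move G (C i) (tpos (C (Suc i))) (bpos (C (Suc i)), marked (C (Suc i))))"

definition traveler_wins :: "'v sabotage_game \<Rightarrow> enat \<Rightarrow> (nat \<Rightarrow> 'v config) \<Rightarrow> bool" where
  "traveler_wins G N C \<longleftrightarrow>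
     (\<exists>i. enat i < N \<and> tpos (C i) \<in> final G \<and> (\<forall>j\<le>i. tpos (C j) \<notin> marked (C j)))"

text \<open>A strategy of the saboteur maps the configurations so far, together with the vertex the
  traveler has just moved to, to the saboteur's reply.\<close>

type_synonym 'v strategy = "'v config list \<Rightarrow> 'v \<Rightarrow> 'v \<times> 'v set"

definition is_strategy :: "'v sabotage_game \<Rightarrow> 'v strategy \<Rightarrow> bool" where
  "is_strategy G \<sigma> \<longleftrightarrow>
     (\<forall>k C t'. is_play G (enat (Suc k)) C \<and> (tpos (C k), t') \<in> edges_T G \<and>
        (\<exists>mv. saboteur_move G (C k) t' mv) \<longrightarrow>
        saboteur_move G (C k) t' (\<sigma> (map C [0..<Suc k]) t'))"

definition agrees :: "'v strategy \<Rightarrow> enat \<Rightarrow> (nat \<Rightarrow> 'v config) \<Rightarrow> bool" where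
  "agrees \<sigma> N C \<longleftrightarrow>
     (\<forall>i. enat (Suc i) < N \<longrightarrow>
        (bpos (C (Suc i)), marked (C (Suc i))) = \<sigma> (map C [0..<Suc i]) (tpos (C (Suc i))))"

text \<open>If the saboteur is at a vertex without outgoing edge, the play breaks off after a move of the
  traveler that is not recorded in any configuration of the play.  Such a move to an unmarked final
  vertex still wins for the traveler, provided she has not occupied a marked vertex before.\<close>

definition traveler_wins_last_move ::
    "'v sabotage_game \<Rightarrow> nat \<Rightarrow> (nat \<Rightarrow> 'v config) \<Rightarrow> 'v \<Rightarrow> bool" where
  "traveler_wins_last_move G k C t' \<longleftrightarrow>
     (tpos (C k), t') \<in> edges_T G \<and> \<not> (\<exists>mv. saboteur_move G (C k) t' mv) \<and>
     t' \<in> final G \<and> t' \<notin> marked (C k) \<and> (\<forall>j\<le>k. tpos (C j) \<notin> marked (C j))"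

definition saboteur_winning :: "'v sabotage_game \<Rightarrow> 'v strategy \<Rightarrow> bool" where
  "saboteur_winning G \<sigma> \<longleftrightarrow>
     is_strategy G \<sigma> \<and>
     (\<forall>N C. is_play G N C \<and> agrees \<sigma> N C \<longrightarrow> \<not> traveler_wins G N C) \<and>
     (\<forall>k C t'. is_play G (enat (Suc k)) C \<and> agrees \<sigma> (enat (Suc k)) C \<longrightarrow>
        \<not> traveler_wins_last_move G k C t')"


section \<open>Computation model\<close>

text \<open>A first-order, call-by-value functional language over binary trees.  The only test on data is
  whether a tree is \<open>Leaf\<close>, and every expression node evaluated costs one step, so a program can be
  run on a pointer machine, with shared subtrees, at constant cost per step.\<close>

datatype val = Leaf | Pair val val

fun left :: "val \<Rightarrow> val" where
  "left Leaf = Leaf"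
| "left (Pair x y) = x"

fun right :: "val \<Rightarrow> val" where
  "right Leaf = Leaf"
| "right (Pair x y) = y"

text \<open>Variables are positions in the environment; \<open>ELet\<close> pushes onto its front.  A program is a list
  of function bodies, and \<open>ECall f es\<close> evaluates body \<open>f\<close> in the environment of the arguments.\<close>

datatype expr =
    EVar nat
  | ELeaf
  | EPair expr expr
  | ELeft expr
  | ERight expr
  | EIf expr expr expr
  | ELet expr expr
  | ECall nat "expr list"

type_synonym prog = "expr list"

inductive eval :: "prog \<Rightarrow> val list \<Rightarrow> expr \<Rightarrow> val \<Rightarrow> nat \<Rightarrow> bool"
  and evals :: "prog \<Rightarrow> val list \<Rightarrow> expr list \<Rightarrow> val list \<Rightarrow> nat \<Rightarrow> bool"
  for P :: prog where
  eval_Var: "i < length env \<Longrightarrow> eval P env (EVar i) (env ! i) 1"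
| eval_Leaf: "eval P env ELeaf Leaf 1"
| eval_Pair: "eval P env a x s \<Longrightarrow> eval P env b y t \<Longrightarrow>
    eval P env (EPair a b) (Pair x y) (s + t + 1)"
| eval_Left: "eval P env a x s \<Longrightarrow> eval P env (ELeft a) (left x) (s + 1)"
| eval_Right: "eval P env a x s \<Longrightarrow> eval P env (ERight a) (right x) (s + 1)"
| eval_If_then: "eval P env a x s \<Longrightarrow> x \<noteq> Leaf \<Longrightarrow> eval P env b y t \<Longrightarrow>
    eval P env (EIf a b c) y (s + t + 1)"
| eval_If_else: "eval P env a Leaf s \<Longrightarrow> eval P env c y t \<Longrightarrow>
    eval P env (EIf a b c) y (s + t + 1)"
| eval_Let: "eval P env a x s \<Longrightarrow> eval P (x # env) b y t \<Longrightarrow>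
    eval P env (ELet a b) y (s + t + 1)"
| eval_Call: "f < length P \<Longrightarrow> evals P env es xs s \<Longrightarrow> eval P xs (P ! f) y t \<Longrightarrow>
    eval P env (ECall f es) y (s + t + 1)"
| evals_Nil: "evals P env [] [] 0"
| evals_Cons: "eval P env e x s \<Longrightarrow> evals P env es xs t \<Longrightarrow>
    evals P env (e # es) (x # xs) (s + t)"

inductive_cases eval_VarE: "eval P env (EVar i) v t"
inductive_cases eval_LeafE: "eval P env ELeaf v t"
inductive_cases eval_PairE: "eval P env (EPair a b) v t"
inductive_cases eval_LeftE: "eval P env (ELeft a) v t"
inductive_cases eval_RightE: "eval P env (ERight a) v t"
inductive_cases eval_IfE: "eval P env (EIf a b c) v t"
inductive_cases eval_LetE: "eval P env (ELet a b) v t"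
inductive_cases eval_CallE: "eval P env (ECall f es) v t"
inductive_cases evals_NilE: "evals P env [] vs t"
inductive_cases evals_ConsE: "evals P env (e # es) vs t"

lemma eval_deterministic:
  "eval P env e v t \<Longrightarrow> eval P env e v' t' \<Longrightarrow> v' = v \<and> t' = t"
  "evals P env es vs t \<Longrightarrow> evals P env es vs' t' \<Longrightarrow> vs' = vs \<and> t' = t"
proof (induction arbitrary: v' t' and vs' t' rule: eval_evals.inducts)
  case eval_Var then show ?case by (auto elim: eval_VarE)
next
  case eval_Leaf then show ?case by (auto elim: eval_LeafE)
next
  case eval_Pair from eval_Pair.prems show ?case
    by (rule eval_PairE) (auto dest!: eval_Pair.IH(2,4))
next
  case eval_Left from eval_Left.prems show ?case
    by (rule eval_LeftE) (auto dest!: eval_Left.IH(2))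
next
  case eval_Right from eval_Right.prems show ?case
    by (rule eval_RightE) (auto dest!: eval_Right.IH(2))
next
  case eval_If_then from eval_If_then.prems show ?case
    by (rule eval_IfE) (use eval_If_then.hyps in \<open>auto dest!: eval_If_then.IH(2,4)\<close>)+
next
  case eval_If_else from eval_If_else.prems show ?case
    by (rule eval_IfE) (auto dest!: eval_If_else.IH(2,4))+
next
  case eval_Let from eval_Let.prems show ?case
    by (rule eval_LetE) (auto dest!: eval_Let.IH(2,4))
next
  case eval_Call from eval_Call.prems show ?case
    by (rule eval_CallE) (auto dest!: eval_Call.IH(3,5))
next
  case evals_Nil then show ?case by (auto elim: evals_NilE)
next
  case evals_Cons from evals_Cons.prems show ?case
    by (rule evals_ConsE) (auto dest!: evals_Cons.IH(2,4))
qed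

text \<open>The size of the result is charged as well, so that sharing cannot hide the cost of writing the
  output down.\<close>

definition computes_in_time :: "prog \<Rightarrow> val \<Rightarrow> val \<Rightarrow> nat \<Rightarrow> bool" where
  "computes_in_time P x y t \<longleftrightarrow>
     (\<exists>s. P \<noteq> [] \<and> eval P [x] (P ! 0) y s \<and> t = s + size y)"


section \<open>Encoding of games and strategies\<close>

fun enc_nat :: "nat \<Rightarrow> val" where
  "enc_nat 0 = Leaf"
| "enc_nat (Suc k) = Pair Leaf (enc_nat k)"

definition enc_list :: "('a \<Rightarrow> val) \<Rightarrow> 'a list \<Rightarrow> val" where
  "enc_list f xs = foldr (\<lambda>x. Pair (f x)) xs Leaf"

fun enc_enat :: "enat \<Rightarrow> val" where
  "enc_enat (enat k) = Pair Leaf (enc_nat k)"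
| "enc_enat \<infinity> = Leaf"

text \<open>Relative to an enumeration \<open>vs\<close> of the vertices, a vertex is given by its index in \<open>vs\<close>, in
  unary.\<close>

definition enc_vertex :: "'v list \<Rightarrow> 'v \<Rightarrow> val" where
  "enc_vertex vs v = enc_nat (length (takeWhile (\<lambda>x. x \<noteq> v) vs))"

definition enc_vertices :: "'v list \<Rightarrow> 'v list \<Rightarrow> val" where
  "enc_vertices vs = enc_list (enc_vertex vs)"

definition enc_set :: "'v list \<Rightarrow> 'v set \<Rightarrow> val" where
  "enc_set vs S = enc_vertices vs (filter (\<lambda>v. v \<in> S) vs)"

definition enc_edges :: "'v list \<Rightarrow> ('v \<times> 'v) set \<Rightarrow> val" where
  "enc_edges vs E =
     enc_list (\<lambda>(u, v). Pair (enc_vertex vs u) (enc_vertex vs v))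
       (filter (\<lambda>e. e \<in> E) (List.product vs vs))"

definition enc_game :: "'v list \<Rightarrow> 'v sabotage_game \<Rightarrow> val" where
  "enc_game vs G = enc_list id
     [enc_set vs (verts G), enc_edges vs (edges_T G), enc_edges vs (edges_B G),
      enc_vertex vs (init_T G), enc_vertex vs (init_B G), enc_enat (budget G),
      enc_list (\<lambda>v. enc_set vs (obs G v)) vs, enc_set vs (final G)]"

text \<open>A computed strategy is output as a table.  An entry \<open>((t', b, Ts), (b', Ts'))\<close> says: when the
  traveler has just moved to \<open>t'\<close> while the saboteur is at \<open>b\<close> and the marked vertices are those of
  \<open>Ts\<close>, move to \<open>b'\<close> and make \<open>Ts'\<close> the marked vertices.\<close>

type_synonym 'v table = "(('v \<times> 'v \<times> 'v list) \<times> ('v \<times> 'v list)) list"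

definition table_strategy :: "'v table \<Rightarrow> 'v strategy" where
  "table_strategy tbl h t' =
     (case find (\<lambda>((t, b, Ts), _). t = t' \<and> b = bpos (last h) \<and> set Ts = marked (last h)) tbl of
        Some (_, (b', Ts')) \<Rightarrow> (b', set Ts')
      | None \<Rightarrow> undefined)"

definition enc_table :: "'v list \<Rightarrow> 'v table \<Rightarrow> val" where
  "enc_table vs = enc_list (\<lambda>((t', b, Ts), (b', Ts')).
     Pair (Pair (enc_vertex vs t') (Pair (enc_vertex vs b) (enc_vertices vs Ts)))
          (Pair (enc_vertex vs b') (enc_vertices vs Ts')))"

end

theory Submission
  imports Defs
begin

text \<open>The saboteur plays a safety game on the positions \<open>(t, b, L)\<close>, where \<open>L\<close> is a list of at most
  \<open>min m n\<close> vertices representing the marked set, so there are only \<open>n ^ O(m)\<close> legal transitions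
  \<open>(t, b, L) \<rightarrow> (b', L')\<close>.  Starting from all of them, one repeatedly discards those after which the
  traveler can move to a position that loses for the saboteur or has no transition left.  The
  transitions prescribed by a winning strategy are never discarded, and conversely every
  strategy that stays inside the limit set wins; the program writes this set down.\<close>

section \<open>Solving the game\<close>

text \<open>A winning strategy may depend on the whole history, while a table sees only the current
  position. \<open>prescribed\<close> bridges this gap: it collects every transition that the given
  strategy makes after some play consistent with it in which the traveler has not yet hit a marked
  vertex, and forgets the history. The set may hold several replies for one position, but each of
  them leads only to \<open>safe\<close> positions. That is what lets it survive every round, and
  since the saboteur's goal is a safety condition, any choice inside the limit set is as good as any
  other.

  The exponent of the bound comes from a bound \<open>K\<close> on the weights of the edge lists,
  the vertex list and the list of representations of marked sets. A transition consists of three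
  vertices and two such representations, so the transition list has weight O(K^5). There are as many
  rounds as transitions, and each round pairs every transition with every edge of the traveler and
  searches the transition list anew: K^5 * K^5 * K * K^5 = K^16. With K = (8 * n^3)^(min m n + 1)
  this crude estimate is still n^O(m).\<close>

primrec shrink :: "('a list \<Rightarrow> 'a \<Rightarrow> bool) \<Rightarrow> nat \<Rightarrow> 'a list \<Rightarrow> 'a list" where
  "shrink g 0 Z = Z"
| "shrink g (Suc k) Z = shrink g k (filter (g Z) Z)"

lemma set_shrink_subset: "set (shrink g k Z) \<subseteq> set Z"
proof (induction k arbitrary: Z)
  case (Suc k)
  then show ?case using Suc.IH[of "filter (g Z) Z"] by auto
qed simp

text \<open>Every round that changes the list drops at least one entry, so \<open>length Z\<close>
  rounds reach a list on which the test removes nothing.\<close>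

lemma shrink_fixpoint:
  "length Z \<le> k \<Longrightarrow> e \<in> set (shrink g k Z) \<Longrightarrow> g (shrink g k Z) e"
proof (induction k arbitrary: Z)
  case (Suc k)
  show ?case
  proof (cases "filter (g Z) Z = Z")
    case True
    then have "shrink g j Z = Z" for j
      by (induction j) simp_all
    with True Suc.prems show ?thesis by (metis filter_id_conv)
  next
    case False
    then have "length (filter (g Z) Z) < length Z"
      by (meson filter_id_conv length_filter_less)
    with Suc show ?thesis by simp
  qed
qed simp

text \<open>Members of \<open>W\<close> pass the test against every list that still contains
  \<open>W\<close>, so no round can remove one. Quantifying over all such lists absorbs the
  monotonicity of the test.\<close>

lemma shrink_greatest:
  assumes "W \<subseteq> set Z" and "\<And>Z e. W \<subseteq> set Z \<Longrightarrow> e \<in> W \<Longrightarrow> g Z e"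
  shows "W \<subseteq> set (shrink g k Z)"
  using assms(1)
proof (induction k arbitrary: Z)
  case (Suc k)
  then have "W \<subseteq> set (filter (g Z) Z)" using assms(2) by auto
  then show ?case using Suc.IH by simp
qed simp

text \<open>Carries the iteration over to encoded transitions. The tests are compared only inside
  \<open>A\<close> because the encoding is faithful only over the enumerated vertices.\<close>

lemma shrink_map:
  assumes "set Z \<subseteq> A"
    and "\<And>Z e. set Z \<subseteq> A \<Longrightarrow> e \<in> set Z \<Longrightarrow> g' (map h Z) (h e) \<longleftrightarrow> g Z e"
  shows "shrink g' k (map h Z) = map h (shrink g k Z)"
  using assms(1)
proof (induction k arbitrary: Z)
  case (Suc k)
  have "filter (g' (map h Z)) (map h Z) = map h (filter (g Z) Z)"
    unfolding filter_map using assms(2)[OF Suc.prems]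
    by (intro arg_cong[where f = "map h"] filter_cong) auto
  then show ?case using Suc.IH[of "filter (g Z) Z"] Suc.prems by auto
qed simp

text \<open>Lists with repetitions and different lists for the same set do no harm: legality and safety
  of a transition depend only on the underlying sets.\<close>

primrec words :: "'v list \<Rightarrow> nat \<Rightarrow> 'v list list" where
  "words vs 0 = [[]]"
| "words vs (Suc k) = [] # map (\<lambda>(v, L). v # L) (List.product vs (words vs k))"

lemma set_words: "set (words vs k) = {L. set L \<subseteq> set vs \<and> length L \<le> k}"
proof (induction k)
  case (Suc k)
  show ?case
  proof (intro set_eqI)
    fix L
    show "L \<in> set (words vs (Suc k)) \<longleftrightarrow> L \<in> {L. set L \<subseteq> set vs \<and> length L \<le> Suc k}"
      by (cases L) (auto simp: Suc)
  qed
qed auto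

type_synonym 'v transition = "('v \<times> 'v \<times> 'v list) \<times> ('v \<times> 'v list)"

definition candidates :: "'v list \<Rightarrow> nat \<Rightarrow> 'v transition list" where
  "candidates vs k = List.product (List.product vs (List.product vs (words vs k)))
     (List.product vs (words vs k))"

text \<open>The budget is enforced by the bounded length of the lists in
  \<open>candidates\<close>.\<close>

definition legal :: "('v \<times> 'v) set \<Rightarrow> 'v transition \<Rightarrow> bool" where
  "legal EB = (\<lambda>((t, b, L), (b', L')). (b, b') \<in> EB \<and> set L \<subseteq> set L' \<and>
     set L' \<subseteq> insert b (insert b' (set L)) \<and> (t \<in> set L' \<longrightarrow> t \<in> set L))"

text \<open>A position is taken just after the traveler's move to \<open>t\<close>. On a marked
  \<open>t\<close> she has already lost, so no reply is demanded. At a dead end of the saboteur the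
  play breaks off, and only a final \<open>t\<close> could do harm.\<close>

definition safe :: "('v \<times> 'v) set \<Rightarrow> 'v set \<Rightarrow> 'v transition set \<Rightarrow> 'v \<times> 'v \<times> 'v list \<Rightarrow> bool"
  where
  "safe EB Fin Z = (\<lambda>(t, b, L). t \<in> set L \<or>
     t \<notin> Fin \<and> (b \<in> Domain EB \<longrightarrow> (t, b, L) \<in> Domain Z))"

lemma safe_mono: "safe EB Fin Z s \<Longrightarrow> Z \<subseteq> Z' \<Longrightarrow> safe EB Fin Z' s"
  by (auto simp: safe_def)

definition good ::
    "('v \<times> 'v) set \<Rightarrow> ('v \<times> 'v) set \<Rightarrow> 'v set \<Rightarrow> 'v transition list \<Rightarrow> 'v transition \<Rightarrow> bool"
  where
  "good ET EB Fin Z = (\<lambda>((t, b, L), (b', L')).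
     \<forall>t''. (t, t'') \<in> ET \<longrightarrow> safe EB Fin (set Z) (t'', b', L'))"

text \<open>The lookup compares marked sets, so the entry found may carry a list \<open>L1\<close>
  different from \<open>L\<close>; but a match in \<open>tbl\<close> always takes precedence over
  \<open>tbl'\<close>.\<close>

lemma table_strategy_cases:
  assumes "((t', bpos (last h), L), mv) \<in> set tbl" "set L = marked (last h)"
  obtains L1 b' L' where "((t', bpos (last h), L1), (b', L')) \<in> set tbl"
    "set L1 = marked (last h)" "table_strategy (tbl @ tbl') h t' = (b', set L')"
proof -
  let ?P = "\<lambda>((t, b, Ts), _). t = t' \<and> b = bpos (last h) \<and> set Ts = marked (last h)"
  have "find ?P tbl \<noteq> None"
    unfolding find_None_iff using assms by blast
  then obtain e where e: "find ?P tbl = Some e" by auto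
  then have "e \<in> set tbl" "?P e"
    unfolding find_Some_iff in_set_conv_nth by auto
  moreover have "find ?P (tbl @ tbl') = Some e"
    using e by (induction tbl) (auto split: if_splits)
  ultimately show ?thesis
    using that by (cases e) (auto simp: table_strategy_def)
qed

section \<open>Correctness of the table: from a winning strategy to the stable transitions and
  back\<close>

locale finite_budget_game =
  fixes G :: "'v sabotage_game" and m :: nat and vs :: "'v list"
  assumes valid: "valid_game G" and budget: "budget G = enat m"
    and vs: "set vs = verts G"
begin

text \<open>The time bound is constant for \<open>n = 1\<close>, whatever \<open>m\<close> is; hence the cap by the number of
  vertices.\<close>

definition max_marks :: nat where
  "max_marks = min m (length vs)"

definition transitions where
  "transitions = filter (legal (edges_B G)) (candidates vs max_marks)"

definition stable where
  "stable = shrink (good (edges_T G) (edges_B G) (final G)) (length transitions) transitions"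

lemma edges_verts: "(x, y) \<in> edges_T G \<Longrightarrow> x \<in> set vs \<and> y \<in> set vs"
  "(x, y) \<in> edges_B G \<Longrightarrow> x \<in> set vs \<and> y \<in> set vs"
  using valid by (auto simp: valid_game_def vs)

text \<open>The cap at \<open>length vs\<close> loses nothing, because a repetition-free list over
  the vertices is no longer than that.\<close>

lemma words_of_set:
  assumes "T \<subseteq> set vs" "card T \<le> m"
  obtains L where "L \<in> set (words vs max_marks)" "set L = T"
proof -
  have "finite T" using assms(1) finite_subset by blast
  then obtain L where L: "set L = T" "distinct L" using finite_distinct_list by blast
  have "card T \<le> length vs"
    using assms(1) by (meson List.finite_set card_length card_mono le_trans)
  with L assms have "L \<in> set (words vs max_marks)"
    by (auto simp: set_words max_marks_def simp flip: distinct_card)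
  with L that show ?thesis by blast
qed

lemma transition_legal:
  "((t, b, L), (b', L')) \<in> set transitions \<Longrightarrow> bpos c = b \<Longrightarrow> marked c = set L \<Longrightarrow>
    saboteur_move G c t (b', set L')"
  using card_length[of L'] by (auto simp: transitions_def legal_def candidates_def
      saboteur_move_def budget set_words max_marks_def)

lemma transition_exists:
  assumes "saboteur_move G c t (b', T')" "marked c = set L"
    "L \<in> set (words vs max_marks)" "t \<in> set vs"
  obtains L' where "((t, bpos c, L), (b', L')) \<in> set transitions" "set L' = T'"
proof -
  have "(bpos c, b') \<in> edges_B G" "T' \<subseteq> marked c \<union> {bpos c, b'}"
    using assms(1) by (simp_all add: saboteur_move_def)
  moreover have "set L \<subseteq> set vs" using assms(3) by (simp add: set_words)
  ultimately have "T' \<subseteq> set vs"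
    using assms(2) edges_verts(2) by blast
  moreover have "card T' \<le> m" using assms(1) by (simp add: saboteur_move_def budget)
  ultimately obtain L' where L': "L' \<in> set (words vs max_marks)" "set L' = T'"
    by (rule words_of_set)
  then have "((t, bpos c, L), (b', L')) \<in> set transitions"
    using assms edges_verts[of "bpos c" b']
    by (auto simp: transitions_def legal_def candidates_def saboteur_move_def)
  with L' that show ?thesis by blast
qed

lemma play_invariant:
  assumes "is_play G N C" "enat i < N"
  shows "marked (C i) \<subseteq> set vs \<and> card (marked (C i)) \<le> m"
  using assms(2)
proof (induction i)
  case 0
  then show ?case using assms(1) by (simp add: is_play_def marked_def)
next
  case (Suc i)
  then have "enat i < N" by (meson Suc_ile_eq order_less_imp_le)
  with Suc have IH: "marked (C i) \<subseteq> set vs" by simp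
  have "saboteur_move G (C i) (tpos (C (Suc i))) (bpos (C (Suc i)), marked (C (Suc i)))"
    using assms(1) Suc.prems by (simp add: is_play_def)
  then have "(bpos (C i), bpos (C (Suc i))) \<in> edges_B G"
    "marked (C (Suc i)) \<subseteq> marked (C i) \<union> {bpos (C i), bpos (C (Suc i))}"
    "card (marked (C (Suc i))) \<le> m"
    by (simp_all add: saboteur_move_def budget)
  then show ?case using IH edges_verts(2) by blast
qed

text \<open>Moving without marking is always allowed: the present marks already respect the budget.
  Hence only a missing edge can block the saboteur.\<close>

lemma saboteur_move_iff_Domain:
  assumes "is_play G N C" "enat i < N"
  shows "(\<exists>mv. saboteur_move G (C i) t mv) \<longleftrightarrow> bpos (C i) \<in> Domain (edges_B G)"
proof
  assume "bpos (C i) \<in> Domain (edges_B G)"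
  then obtain b' where "(bpos (C i), b') \<in> edges_B G" by blast
  then have "saboteur_move G (C i) t (b', marked (C i))"
    using play_invariant[OF assms] by (auto simp: saboteur_move_def budget)
  then show "\<exists>mv. saboteur_move G (C i) t mv" by blast
qed (auto simp: saboteur_move_def)

context
  fixes \<sigma> assumes \<sigma>: "saboteur_winning G \<sigma>"
begin

definition open_play where
  "open_play i C \<longleftrightarrow> is_play G (enat (Suc i)) C \<and> agrees \<sigma> (enat (Suc i)) C \<and>
     (\<forall>j\<le>i. tpos (C j) \<notin> marked (C j))"

definition prescribed where
  "prescribed = {((t, b, L), (b', L')) \<in> set transitions. \<exists>i C. open_play i C \<and>
     (tpos (C i), t) \<in> edges_T G \<and> t \<notin> set L \<and> bpos (C i) = b \<and> marked (C i) = set L \<and>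
     \<sigma> (map C [0..<Suc i]) t = (b', set L')}"

lemma open_play_extend:
  assumes "open_play i C" "(tpos (C i), t) \<in> edges_T G" "t \<notin> marked (C i)"
    "\<sigma> (map C [0..<Suc i]) t = (b', T')" "saboteur_move G (C i) t (b', T')"
  shows "open_play (Suc i) (C(Suc i := (t, b', T')))"
proof -
  let ?C = "C(Suc i := (t, b', T'))"
  have m: "map ?C [0..<Suc j] = map C [0..<Suc j]" if "j \<le> i" for j
    using that by auto
  have "t \<notin> T'" using assms(3,5) by (auto simp: saboteur_move_def)
  moreover have "is_play G (enat (Suc (Suc i))) ?C"
    using assms by (auto simp: open_play_def is_play_def less_Suc_eq tpos_def bpos_def marked_def
        enat_0_iff)
  moreover have "agrees \<sigma> (enat (Suc (Suc i))) ?C"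
    using assms unfolding open_play_def agrees_def
    by (auto simp: less_Suc_eq m tpos_def bpos_def marked_def simp del: upt_Suc)
  ultimately show ?thesis
    using assms by (auto simp: open_play_def le_Suc_eq tpos_def marked_def)
qed

lemma open_play_not_final: "open_play i C \<Longrightarrow> tpos (C i) \<notin> final G"
  using \<sigma> unfolding open_play_def saboteur_winning_def traveler_wins_def
  by (metis enat_ord_simps(2) lessI)

text \<open>The strategy's own reply extends the play, which shows that \<open>t\<close> is not
  final, and it also supplies the entry in \<open>prescribed\<close>. At a dead end, the winning
  condition on the unrecorded last move excludes a final \<open>t\<close>.\<close>

lemma open_play_safe:
  assumes "open_play i C" "(tpos (C i), t) \<in> edges_T G" "L \<in> set (words vs max_marks)"
    "marked (C i) = set L"
  shows "safe (edges_B G) (final G) prescribed (t, bpos (C i), L)"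
proof (cases "t \<in> set L")
  case False
  have play: "is_play G (enat (Suc i)) C" using assms by (simp add: open_play_def)
  note move_iff = saboteur_move_iff_Domain[OF play, of i t]
  show ?thesis
  proof (cases "bpos (C i) \<in> Domain (edges_B G)")
    case True
    obtain b' T' where mv: "\<sigma> (map C [0..<Suc i]) t = (b', T')" by fastforce
    have sm: "saboteur_move G (C i) t (b', T')"
      using \<sigma> True move_iff assms play mv
      unfolding saboteur_winning_def is_strategy_def by (metis enat_ord_simps(2) lessI)
    have "t \<notin> final G"
      using open_play_not_final[OF open_play_extend[OF assms(1,2) _ mv sm]] False assms(4)
      by (simp add: tpos_def)
    moreover obtain L' where L': "((t, bpos (C i), L), (b', L')) \<in> set transitions" "set L' = T'"
      using transition_exists[OF sm assms(4,3)] edges_verts(1)[OF assms(2)] by blast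
    then have "((t, bpos (C i), L), (b', L')) \<in> prescribed"
      using assms mv False unfolding prescribed_def by blast
    ultimately show ?thesis by (auto simp: safe_def)
  next
    case dead: False
    then have "\<not> traveler_wins_last_move G i C t"
      using \<sigma> assms(1) by (auto simp: open_play_def saboteur_winning_def)
    then show ?thesis
      using dead move_iff assms False
      by (auto simp: safe_def traveler_wins_last_move_def open_play_def)
  qed
qed (simp add: safe_def)

text \<open>Appending a prescribed transition to the play that witnesses it gives an open play
  ending in the successor position, where \<open>open_play_safe\<close> applies to every answer of
  the traveler.\<close>

lemma prescribed_stable: "prescribed \<subseteq> set stable"
  unfolding stable_def
proof (rule shrink_greatest)
  show "prescribed \<subseteq> set transitions" by (auto simp: prescribed_def)
next
  fix Z e
  assume Z: "prescribed \<subseteq> set Z" and e: "e \<in> prescribed"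
  obtain t b L b' L' where e_eq: "e = ((t, b, L), (b', L'))" by (metis prod.exhaust)
  with e obtain i C where tr: "((t, b, L), (b', L')) \<in> set transitions"
    and p: "open_play i C" "(tpos (C i), t) \<in> edges_T G" "t \<notin> marked (C i)"
      "\<sigma> (map C [0..<Suc i]) t = (b', set L')"
    and c: "bpos (C i) = b" "marked (C i) = set L"
    by (auto simp: prescribed_def)
  let ?C = "C(Suc i := (t, b', set L'))"
  have "open_play (Suc i) ?C"
    using open_play_extend[OF p transition_legal[OF tr c]] .
  moreover have "L' \<in> set (words vs max_marks)"
    using tr by (auto simp: transitions_def candidates_def)
  ultimately have "safe (edges_B G) (final G) prescribed (t'', b', L')"
    if "(t, t'') \<in> edges_T G" for t''
    using open_play_safe[of "Suc i" ?C t'' L'] that by (simp add: tpos_def bpos_def marked_def)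
  then show "good (edges_T G) (edges_B G) (final G) Z e"
    using safe_mono[OF _ Z] by (auto simp: good_def e_eq)
qed

lemma initial_safe:
  "init_T G \<notin> final G"
  "(init_T G, t) \<in> edges_T G \<Longrightarrow> safe (edges_B G) (final G) (set stable) (t, init_B G, [])"
proof -
  \<comment> \<open>A play of one configuration looks at index 0 only, so a constant sequence
    serves.\<close>
  let ?C = "\<lambda>_. (init_T G, init_B G, {})"
  have op: "open_play 0 ?C"
    by (auto simp: open_play_def is_play_def agrees_def tpos_def marked_def enat_0_iff)
  show "init_T G \<notin> final G" using open_play_not_final[OF op] by (simp add: tpos_def)
  show "safe (edges_B G) (final G) (set stable) (t, init_B G, [])" if "(init_T G, t) \<in> edges_T G"
    using open_play_safe[OF op, of t "[]"] that
    by (intro safe_mono[OF _ prescribed_stable]) (simp add: tpos_def bpos_def marked_def set_words)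
qed

end

lemma stable_subset: "set stable \<subseteq> set transitions"
  by (simp add: stable_def set_shrink_subset)

lemma stable_good: "e \<in> set stable \<Longrightarrow> good (edges_T G) (edges_B G) (final G) stable e"
  unfolding stable_def by (rule shrink_fixpoint) auto

text \<open>The lookup takes the first matching entry, so \<open>transitions\<close> only supplies legal replies in the
  positions that \<open>stable\<close> does not cover.\<close>

lemma is_strategy_table: "is_strategy G (table_strategy (stable @ transitions))"
  unfolding is_strategy_def
proof (intro allI impI, elim conjE exE)
  fix i C t' and mv
  assume play: "is_play G (enat (Suc i)) C" and t': "(tpos (C i), t') \<in> edges_T G"
    and mv: "saboteur_move G (C i) t' mv"
  obtain b1 T1 where [simp]: "mv = (b1, T1)" by fastforce
  obtain L where L: "L \<in> set (words vs max_marks)" "set L = marked (C i)"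
    using play_invariant[OF play, of i] words_of_set by auto
  let ?h = "map C [0..<Suc i]"
  have last: "last ?h = C i" by simp
  obtain L1 where "((t', bpos (C i), L), (b1, L1)) \<in> set transitions"
    using transition_exists[of "C i" t' b1 T1 L] mv L edges_verts(1)[OF t'] by auto
  then obtain L2 b' L' where "((t', bpos (C i), L2), (b', L')) \<in> set (stable @ transitions)"
    "set L2 = marked (C i)" "table_strategy (stable @ transitions) ?h t' = (b', set L')"
    using table_strategy_cases[of t' ?h L "(b1, L1)" "stable @ transitions" "[]"] L(2) last
    by (metis append_Nil2 UnCI set_append)
  then show "saboteur_move G (C i) t' (table_strategy (stable @ transitions) ?h t')"
    using transition_legal[of t' "bpos (C i)" L2 b' L' "C i"] stable_subset by auto
qed

text \<open>The list is existentially quantified because the lookup may pick an entry with another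
  list for the same marks. That entry is itself stable, so its own target list carries the invariant
  on.\<close>

lemma table_play_invariant:
  assumes "saboteur_winning G \<sigma>"
    and play: "is_play G N C" and ag: "agrees (table_strategy (stable @ transitions)) N C"
  shows "enat i < N \<Longrightarrow> (\<forall>j\<le>i. tpos (C j) \<notin> marked (C j)) \<Longrightarrow>
    tpos (C i) \<notin> final G \<and> (\<exists>L. set L = marked (C i) \<and> (\<forall>t. (tpos (C i), t) \<in> edges_T G \<longrightarrow>
      safe (edges_B G) (final G) (set stable) (t, bpos (C i), L)))"
proof (induction i)
  case 0
  have "C 0 = (init_T G, init_B G, {})" using play by (simp add: is_play_def)
  then show ?case using initial_safe[OF assms(1)]
    by (auto simp: tpos_def bpos_def marked_def intro!: exI[of _ "[]"])
next
  case (Suc i)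
  let ?t = "tpos (C (Suc i))" and ?h = "map C [0..<Suc i]"
  have last: "last ?h = C i" by simp
  have "enat i < N" using Suc.prems(1) by (meson Suc_ile_eq order_less_imp_le)
  with Suc obtain L where L: "set L = marked (C i)"
    "\<forall>t. (tpos (C i), t) \<in> edges_T G \<longrightarrow>
      safe (edges_B G) (final G) (set stable) (t, bpos (C i), L)"
    by auto
  have step: "(tpos (C i), ?t) \<in> edges_T G"
    "saboteur_move G (C i) ?t (bpos (C (Suc i)), marked (C (Suc i)))"
    using play Suc.prems(1) by (simp_all add: is_play_def)
  then have safe: "safe (edges_B G) (final G) (set stable) (?t, bpos (C i), L)"
    using L by blast
  \<comment> \<open>Marks are never removed, so \<open>?t\<close> was unmarked before the reply, and
    the recorded reply proves that the saboteur had an edge. The remaining clause of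
    \<open>safe\<close> yields a stable entry.\<close>
  have "?t \<notin> set L" "bpos (C i) \<in> Domain (edges_B G)"
    using step(2) Suc.prems(2) L(1) by (auto simp: saboteur_move_def)
  with safe obtain mv where fin: "?t \<notin> final G" and "((?t, bpos (C i), L), mv) \<in> set stable"
    by (auto simp: safe_def)
  then obtain L1 b' L' where e: "((?t, bpos (C i), L1), (b', L')) \<in> set stable"
    "table_strategy (stable @ transitions) ?h ?t = (b', set L')"
    using table_strategy_cases[of ?t ?h L mv stable transitions] L(1) last by metis
  then have "bpos (C (Suc i)) = b'" "marked (C (Suc i)) = set L'"
    using ag Suc.prems(1) by (auto simp: agrees_def simp del: upt_Suc)
  with stable_good[OF e(1)] fin show ?case by (auto simp: good_def)
qed

theorem table_winning:
  assumes "saboteur_winning G \<sigma>"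
  shows "saboteur_winning G (table_strategy (stable @ transitions))"
  unfolding saboteur_winning_def
proof (intro conjI allI impI is_strategy_table; elim conjE)
  fix N C assume "is_play G N C" "agrees (table_strategy (stable @ transitions)) N C"
  from table_play_invariant[OF assms this] show "\<not> traveler_wins G N C"
    by (auto simp: traveler_wins_def)
next
  fix i C t
  assume "is_play G (enat (Suc i)) C"
    "agrees (table_strategy (stable @ transitions)) (enat (Suc i)) C"
  from table_play_invariant[OF assms this, of i] show "\<not> traveler_wins_last_move G i C t"
    by (auto simp: traveler_wins_last_move_def safe_def)
qed

end

section \<open>Cost semantics of programs\<close>

text \<open>Calls are answered by \<open>F\<close> and not unfolded, which keeps the recursion
  structural even for recursive programs.\<close>

fun meaning :: "(nat \<Rightarrow> val list \<Rightarrow> val) \<Rightarrow> val list \<Rightarrow> expr \<Rightarrow> val" where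
  "meaning F env (EVar i) = env ! i"
| "meaning F env ELeaf = Leaf"
| "meaning F env (EPair a b) = Pair (meaning F env a) (meaning F env b)"
| "meaning F env (ELeft a) = left (meaning F env a)"
| "meaning F env (ERight a) = right (meaning F env a)"
| "meaning F env (EIf a b c) =
     (if meaning F env a \<noteq> Leaf then meaning F env b else meaning F env c)"
| "meaning F env (ELet a b) = meaning F (meaning F env a # env) b"
| "meaning F env (ECall f es) = F f (map (meaning F env) es)"

fun cost :: "(nat \<Rightarrow> val list \<Rightarrow> val) \<Rightarrow> (nat \<Rightarrow> val list \<Rightarrow> nat) \<Rightarrow> val list \<Rightarrow> expr \<Rightarrow> nat"
  where
  "cost F T env (EVar i) = 1"
| "cost F T env ELeaf = 1"
| "cost F T env (EPair a b) = cost F T env a + cost F T env b + 1"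
| "cost F T env (ELeft a) = cost F T env a + 1"
| "cost F T env (ERight a) = cost F T env a + 1"
| "cost F T env (EIf a b c) = cost F T env a +
     (if meaning F env a \<noteq> Leaf then cost F T env b else cost F T env c) + 1"
| "cost F T env (ELet a b) = cost F T env a + cost F T (meaning F env a # env) b + 1"
| "cost F T env (ECall f es) =
     sum_list (map (cost F T env) es) + T f (map (meaning F env) es) + 1"

fun wf_expr :: "nat list \<Rightarrow> nat \<Rightarrow> expr \<Rightarrow> bool" where
  "wf_expr ar k (EVar i) = (i < k)"
| "wf_expr ar k ELeaf = True"
| "wf_expr ar k (EPair a b) = (wf_expr ar k a \<and> wf_expr ar k b)"
| "wf_expr ar k (ELeft a) = wf_expr ar k a"
| "wf_expr ar k (ERight a) = wf_expr ar k a"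
| "wf_expr ar k (EIf a b c) = (wf_expr ar k a \<and> wf_expr ar k b \<and> wf_expr ar k c)"
| "wf_expr ar k (ELet a b) = (wf_expr ar k a \<and> wf_expr ar (Suc k) b)"
| "wf_expr ar k (ECall f es) =
     (0 < f \<and> f < length ar \<and> length es = ar ! f \<and> list_all (wf_expr ar k) es)"

lemma evals_of_eval:
  assumes "\<And>e. e \<in> set es \<Longrightarrow> \<exists>s\<le>T e. eval P env e (V e) s"
  shows "\<exists>s\<le>sum_list (map T es). evals P env es (map V es) s"
  using assms
proof (induction es)
  case Nil
  then show ?case by (auto intro: evals_Nil)
next
  case (Cons e es)
  then obtain s t where "s \<le> T e" "eval P env e (V e) s"
    "t \<le> sum_list (map T es)" "evals P env es (map V es) t"
    by fastforce
  then show ?case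
    by (intro exI[of _ "s + t"]) (auto intro: evals_Cons)
qed

text \<open>The specifications \<open>F\<close> and \<open>T\<close> of the values and the costs need only be compatible with one
  unfolding of each function body: every call costs one extra step, so induction on the cost bound
  deals with the recursion.\<close>

theorem eval_if_meaning_cost:
  assumes len: "length P = length ar"
    and body: "\<And>f xs. 0 < f \<Longrightarrow> f < length ar \<Longrightarrow> length xs = ar ! f \<Longrightarrow>
      wf_expr ar (ar ! f) (P ! f) \<and> meaning F xs (P ! f) = F f xs \<and>
      cost F T xs (P ! f) \<le> T f xs"
  shows "wf_expr ar (length env) e \<Longrightarrow>
    \<exists>s\<le>cost F T env e. eval P env e (meaning F env e) s"
proof (induction "cost F T env e" arbitrary: env e rule: less_induct)
  case less
  have IH: "\<exists>s\<le>cost F T env' e'. eval P env' e' (meaning F env' e') s"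
    if "cost F T env' e' < cost F T env e" "wf_expr ar (length env') e'" for env' e'
    using less.hyps that by blast
  show ?case
  proof (cases e)
    case (EVar i)
    then show ?thesis using less.prems eval_Var[of i env P] by auto
  next
    case ELeaf
    then show ?thesis using eval_Leaf[of P env] by auto
  next
    case (EPair a b)
    then obtain s t where "s \<le> cost F T env a" "eval P env a (meaning F env a) s"
      "t \<le> cost F T env b" "eval P env b (meaning F env b) t"
      using IH[of env a] IH[of env b] less.prems by auto
    then show ?thesis using EPair
      by (intro exI[of _ "s + t + 1"]) (auto intro!: eval_Pair[simplified])
  next
    case (ELeft a)
    then obtain s where "s \<le> cost F T env a" "eval P env a (meaning F env a) s"
      using IH[of env a] less.prems by auto
    then show ?thesis using ELeft
      by (intro exI[of _ "s + 1"]) (auto intro!: eval_Left[simplified])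
  next
    case (ERight a)
    then obtain s where "s \<le> cost F T env a" "eval P env a (meaning F env a) s"
      using IH[of env a] less.prems by auto
    then show ?thesis using ERight
      by (intro exI[of _ "s + 1"]) (auto intro!: eval_Right[simplified])
  next
    case (EIf a b c)
    then obtain s where s: "s \<le> cost F T env a" "eval P env a (meaning F env a) s"
      using IH[of env a] less.prems by auto
    show ?thesis
    proof (cases "meaning F env a = Leaf")
      case True
      then obtain t where "t \<le> cost F T env c" "eval P env c (meaning F env c) t"
        using IH[of env c] less.prems EIf by auto
      with s True EIf show ?thesis
        by (intro exI[of _ "s + t + 1"]) (auto intro!: eval_If_else[simplified])
    next
      case False
      then obtain t where "t \<le> cost F T env b" "eval P env b (meaning F env b) t"
        using IH[of env b] less.prems EIf by auto
      with s False EIf show ?thesis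
        by (intro exI[of _ "s + t + 1"]) (auto intro!: eval_If_then[simplified])
    qed
  next
    case (ELet a b)
    let ?x = "meaning F env a"
    obtain s t where "s \<le> cost F T env a" "eval P env a ?x s"
      "t \<le> cost F T (?x # env) b" "eval P (?x # env) b (meaning F (?x # env) b) t"
      using IH[of env a] IH[of "?x # env" b] less.prems ELet by auto
    then show ?thesis using ELet
      by (intro exI[of _ "s + t + 1"]) (auto intro!: eval_Let[simplified])
  next
    case (ECall f es)
    let ?xs = "map (meaning F env) es"
    have wf: "0 < f" "f < length ar" "length ?xs = ar ! f" "list_all (wf_expr ar (length env)) es"
      using less.prems ECall by auto
    have "\<exists>s\<le>cost F T env e'. eval P env e' (meaning F env e') s" if "e' \<in> set es" for e'
    proof (rule IH)
      show "wf_expr ar (length env) e'" using wf(4) that by (auto simp: list_all_iff)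
      have "cost F T env e' \<le> sum_list (map (cost F T env) es)"
        using that by (intro member_le_sum_list) auto
      then show "cost F T env e' < cost F T env e" using ECall by simp
    qed
    from evals_of_eval[of es "cost F T env", OF this]
    obtain s where s: "s \<le> sum_list (map (cost F T env) es)" "evals P env es ?xs s"
      by blast
    have b: "wf_expr ar (length ?xs) (P ! f)" "meaning F ?xs (P ! f) = F f ?xs"
      "cost F T ?xs (P ! f) \<le> T f ?xs"
      using body[OF wf(1-3)] wf(3) by auto
    then obtain t where "t \<le> cost F T ?xs (P ! f)" "eval P ?xs (P ! f) (F f ?xs) t"
      using IH[of ?xs "P ! f"] ECall by auto
    with b s wf len ECall show ?thesis
      by (intro exI[of _ "s + t + 1"]) (auto intro!: eval_Call[simplified])
  qed
qed

section \<open>Trees read as lists, and the tests of the solver on trees\<close>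

fun elems :: "val \<Rightarrow> val list" where
  "elems Leaf = []"
| "elems (Pair x y) = x # elems y"

abbreviation mk :: "val list \<Rightarrow> val" where
  "mk \<equiv> enc_list id"

abbreviation truth :: "bool \<Rightarrow> val" where
  "truth b \<equiv> (if b then Pair Leaf Leaf else Leaf)"

text \<open>Used instead of \<open>size\<close> because it is additive and positive.\<close>

fun wt :: "val \<Rightarrow> nat" where
  "wt Leaf = 1"
| "wt (Pair x y) = wt x + wt y"

lemma wt_eq: "wt x = size x + 1"
  by (induction x) auto

lemma wt_pos: "0 < wt x"
  by (simp add: wt_eq)

lemma enc_list_simps [simp]:
  "enc_list f [] = Leaf" "enc_list f (x # xs) = Pair (f x) (enc_list f xs)"
  by (simp_all add: enc_list_def)

lemma elems_enc_list [simp]: "elems (enc_list f xs) = map f xs"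
  by (induction xs) auto

text \<open>Every tree is a list along its right spine. So the specifications make sense for
  arbitrary arguments, as \<open>eval_if_meaning_cost\<close> demands, and not only for
  encodings.\<close>

lemma mk_elems [simp]: "mk (elems x) = x"
  by (induction x) auto

lemma mk_map: "mk (map f xs) = enc_list f xs"
  by (induction xs) auto

lemma wt_enc_list: "wt (enc_list f xs) = (\<Sum>x\<leftarrow>xs. wt (f x)) + 1"
  by (induction xs) auto

text \<open>The recursion depth of \<open>call_words\<close>. Descending in the unary budget and in
  a list at once realizes the minimum of budget and length without arithmetic.\<close>

fun depth :: "val \<Rightarrow> val \<Rightarrow> nat" where
  "depth (Pair _ m) (Pair _ w) = Suc (depth m w)"
| "depth m w = 0"

text \<open>This and the next two definitions mirror \<open>legal\<close>, \<open>safe\<close> and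
  \<open>good\<close> on arbitrary trees; \<open>legal_val_enc\<close> and
  \<open>good_val_enc\<close> relate them to the originals on encodings.\<close>

definition legal_val :: "val \<Rightarrow> val \<Rightarrow> bool" where
  "legal_val EB e = (let t = left (left e); b = left (right (left e)); L = right (right (left e));
       b' = left (right e); L' = right (right e) in
     Pair b b' \<in> set (elems EB) \<and> set (elems L) \<subseteq> set (elems L') \<and>
     set (elems L') \<subseteq> insert b (insert b' (set (elems L))) \<and>
     (t \<in> set (elems L') \<longrightarrow> t \<in> set (elems L)))"

definition safe_val :: "val \<Rightarrow> val \<Rightarrow> val \<Rightarrow> val \<Rightarrow> val \<Rightarrow> val \<Rightarrow> bool" where
  "safe_val t b L Z EB Fin \<longleftrightarrow> t \<in> set (elems L) \<or>
     t \<notin> set (elems Fin) \<and>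
     (b \<in> left ` set (elems EB) \<longrightarrow> Pair t (Pair b L) \<in> left ` set (elems Z))"

definition good_val :: "val \<Rightarrow> val \<Rightarrow> val \<Rightarrow> val list \<Rightarrow> val \<Rightarrow> bool" where
  "good_val ET EB Fin Z e \<longleftrightarrow> (\<forall>d\<in>set (elems ET). left d = left (left e) \<longrightarrow>
     safe_val (right d) (left (right e)) (right (right e)) (mk Z) EB Fin)"

section \<open>The program\<close>

abbreviation "call_eq x y \<equiv> ECall 1 [x, y]"
abbreviation "call_member x ys \<equiv> ECall 2 [x, ys]"
abbreviation "call_has_key k ys \<equiv> ECall 3 [k, ys]"
abbreviation "call_subset xs ys \<equiv> ECall 4 [xs, ys]"
abbreviation "call_pair_with x ys zs \<equiv> ECall 5 [x, ys, zs]"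
abbreviation "call_product xs ys \<equiv> ECall 6 [xs, ys]"
abbreviation "call_words m w V \<equiv> ECall 7 [m, w, V]"
abbreviation "call_legal e EB \<equiv> ECall 8 [e, EB]"
abbreviation "call_filter_legal es EB \<equiv> ECall 9 [es, EB]"
abbreviation "call_safe t b L Z EB Fin \<equiv> ECall 10 [t, b, L, Z, EB, Fin]"
abbreviation "call_good e ET Z EB Fin \<equiv> ECall 11 [e, ET, Z, EB, Fin]"
abbreviation "call_filter_good es ET Z EB Fin \<equiv> ECall 12 [es, ET, Z, EB, Fin]"
abbreviation "call_shrink k ET Z EB Fin \<equiv> ECall 13 [k, ET, Z, EB, Fin]"
abbreviation "call_append xs ys \<equiv> ECall 14 [xs, ys]"

abbreviation "etrue \<equiv> EPair ELeaf ELeaf"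


abbreviation component :: "nat \<Rightarrow> nat \<Rightarrow> expr" where
  "component i k \<equiv> ELeft ((ERight ^^ k) (EVar i))"

text \<open>The components 0, 1, 2, 5, 7 of an encoded game are the vertices, the edges of the traveler and
  of the saboteur, the budget (tagged as finite) and the final vertices.\<close>

definition main_body :: expr where
  "main_body =
     ELet (call_words (ERight (component 0 5)) (component 0 0) (component 0 0))
    (ELet (call_filter_legal
            (call_product (call_product (component 1 0) (call_product (component 1 0) (EVar 0)))
              (call_product (component 1 0) (EVar 0)))
            (component 1 2))
       (call_append
         (call_shrink (EVar 0) (component 2 1) (EVar 0) (component 2 2) (component 2 7))
         (EVar 0)))"

definition eq_body :: expr where
  "eq_body =
    EIf (EVar 0)
     (EIf (EVar 1)
       (EIf (call_eq (ELeft (EVar 0)) (ELeft (EVar 1)))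
         (call_eq (ERight (EVar 0)) (ERight (EVar 1))) ELeaf) ELeaf)
     (EIf (EVar 1) ELeaf etrue)"

definition member_body :: expr where
  "member_body =
    EIf (EVar 1)
     (EIf (call_eq (EVar 0) (ELeft (EVar 1))) etrue (call_member (EVar 0) (ERight (EVar 1))))
     ELeaf"

definition has_key_body :: expr where
  "has_key_body =
    EIf (EVar 1)
     (EIf (call_eq (EVar 0) (ELeft (ELeft (EVar 1)))) etrue
       (call_has_key (EVar 0) (ERight (EVar 1))))
     ELeaf"

definition subset_body :: expr where
  "subset_body =
    EIf (EVar 0)
     (EIf (call_member (ELeft (EVar 0)) (EVar 1)) (call_subset (ERight (EVar 0)) (EVar 1)) ELeaf)
     etrue"

text \<open>The third argument is the rest of the product, so that products are built without
  appending.\<close>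

definition pair_with_body :: expr where
  "pair_with_body =
    EIf (EVar 1)
     (EPair (EPair (EVar 0) (ELeft (EVar 1)))
       (call_pair_with (EVar 0) (ERight (EVar 1)) (EVar 2)))
     (EVar 2)"

definition product_body :: expr where
  "product_body =
    EIf (EVar 0)
     (call_pair_with (ELeft (EVar 0)) (EVar 1) (call_product (ERight (EVar 0)) (EVar 1)))
     ELeaf"

text \<open>Here \<open>etrue\<close> is the list whose only entry is the empty word. The second
  argument is a counter; \<open>main_body\<close> passes the vertex list both there and as the
  alphabet.\<close>

definition words_body :: expr where
  "words_body =
    EIf (EVar 0)
     (EIf (EVar 1)
       (EPair ELeaf (call_product (EVar 2)
         (call_words (ERight (EVar 0)) (ERight (EVar 1)) (EVar 2))))
       etrue)
     etrue"

definition legal_body :: expr where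
  "legal_body =
    EIf (call_member (EPair (ELeft (ERight (ELeft (EVar 0)))) (ELeft (ERight (EVar 0)))) (EVar 1))
     (EIf (call_subset (ERight (ERight (ELeft (EVar 0)))) (ERight (ERight (EVar 0))))
       (EIf (call_subset (ERight (ERight (EVar 0)))
              (EPair (ELeft (ERight (ELeft (EVar 0))))
                (EPair (ELeft (ERight (EVar 0))) (ERight (ERight (ELeft (EVar 0)))))))
         (EIf (call_member (ELeft (ELeft (EVar 0))) (ERight (ERight (EVar 0))))
           (call_member (ELeft (ELeft (EVar 0))) (ERight (ERight (ELeft (EVar 0)))))
           etrue)
         ELeaf)
       ELeaf)
     ELeaf"

definition filter_legal_body :: expr where
  "filter_legal_body =
    EIf (EVar 0)
     (EIf (call_legal (ELeft (EVar 0)) (EVar 1))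
       (EPair (ELeft (EVar 0)) (call_filter_legal (ERight (EVar 0)) (EVar 1)))
       (call_filter_legal (ERight (EVar 0)) (EVar 1)))
     ELeaf"

definition safe_body :: expr where
  "safe_body =
    EIf (call_member (EVar 0) (EVar 2)) etrue
     (EIf (call_member (EVar 0) (EVar 5)) ELeaf
       (EIf (call_has_key (EVar 1) (EVar 4))
         (call_has_key (EPair (EVar 0) (EPair (EVar 1) (EVar 2))) (EVar 3))
         etrue))"

definition good_body :: expr where
  "good_body =
    EIf (EVar 1)
     (EIf (call_eq (ELeft (ELeft (EVar 1))) (ELeft (ELeft (EVar 0))))
       (EIf (call_safe (ERight (ELeft (EVar 1))) (ELeft (ERight (EVar 0)))
              (ERight (ERight (EVar 0))) (EVar 2) (EVar 3) (EVar 4))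
         (call_good (EVar 0) (ERight (EVar 1)) (EVar 2) (EVar 3) (EVar 4))
         ELeaf)
       (call_good (EVar 0) (ERight (EVar 1)) (EVar 2) (EVar 3) (EVar 4)))
     etrue"

definition filter_good_body :: expr where
  "filter_good_body =
    EIf (EVar 0)
     (EIf (call_good (ELeft (EVar 0)) (EVar 1) (EVar 2) (EVar 3) (EVar 4))
       (EPair (ELeft (EVar 0))
         (call_filter_good (ERight (EVar 0)) (EVar 1) (EVar 2) (EVar 3) (EVar 4)))
       (call_filter_good (ERight (EVar 0)) (EVar 1) (EVar 2) (EVar 3) (EVar 4)))
     ELeaf"

text \<open>The first argument only counts rounds; \<open>main_body\<close> passes the transition
  list itself.\<close>

definition shrink_body :: expr where
  "shrink_body =
    EIf (EVar 0)
     (call_shrink (ERight (EVar 0)) (EVar 1)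
       (call_filter_good (EVar 2) (EVar 1) (EVar 2) (EVar 3) (EVar 4)) (EVar 3) (EVar 4))
     (EVar 2)"

definition append_body :: expr where
  "append_body =
    EIf (EVar 0)
     (EPair (ELeft (EVar 0)) (call_append (ERight (EVar 0)) (EVar 1)))
     (EVar 1)"

definition solver :: prog where
  "solver =
    [main_body, eq_body, member_body, has_key_body, subset_body, pair_with_body,
     product_body, words_body, legal_body, filter_legal_body, safe_body, good_body,
     filter_good_body, shrink_body, append_body]"

lemmas solver_defs =
  solver_def eq_body_def member_body_def has_key_body_def subset_body_def pair_with_body_def
  product_body_def words_body_def legal_body_def filter_legal_body_def safe_body_def
  good_body_def filter_good_body_def shrink_body_def append_body_def

definition solver_arities :: "nat list" where
  "solver_arities = [1, 2, 2, 2, 2, 3, 2, 3, 2, 2, 6, 5, 5, 5, 2]"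

section \<open>Specified values and costs of the functions of the program\<close>

definition val_product :: "val \<Rightarrow> val \<Rightarrow> val" where
  "val_product X Y = mk (map (\<lambda>(x, y). Pair x y) (List.product (elems X) (elems Y)))"

fun val_words :: "val \<Rightarrow> val \<Rightarrow> val \<Rightarrow> val" where
  "val_words (Pair _ m) (Pair _ w) V = Pair Leaf (val_product V (val_words m w V))"
| "val_words m w V = Pair Leaf Leaf"

text \<open>Entry \<open>0\<close> is a dummy here and in \<open>time\<close>: the main program is never called.\<close>

definition result :: "nat \<Rightarrow> val list \<Rightarrow> val" where
  "result f xs = (
    [\<lambda>_. Leaf,
     \<lambda>a. truth (a ! 0 = a ! 1),
     \<lambda>a. truth (a ! 0 \<in> set (elems (a ! 1))),
     \<lambda>a. truth (a ! 0 \<in> left ` set (elems (a ! 1))),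
     \<lambda>a. truth (set (elems (a ! 0)) \<subseteq> set (elems (a ! 1))),
     \<lambda>a. mk (map (Pair (a ! 0)) (elems (a ! 1)) @ elems (a ! 2)),
     \<lambda>a. val_product (a ! 0) (a ! 1),
     \<lambda>a. val_words (a ! 0) (a ! 1) (a ! 2),
     \<lambda>a. truth (legal_val (a ! 1) (a ! 0)),
     \<lambda>a. mk (filter (legal_val (a ! 1)) (elems (a ! 0))),
     \<lambda>a. truth (safe_val (a ! 0) (a ! 1) (a ! 2) (a ! 3) (a ! 4) (a ! 5)),
     \<lambda>a. truth (good_val (a ! 1) (a ! 3) (a ! 4) (elems (a ! 2)) (a ! 0)),
     \<lambda>a. mk (filter (good_val (a ! 1) (a ! 3) (a ! 4) (elems (a ! 2))) (elems (a ! 0))),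
     \<lambda>a. mk (shrink (good_val (a ! 1) (a ! 3) (a ! 4)) (length (elems (a ! 0))) (elems (a ! 2))),
     \<lambda>a. mk (elems (a ! 0) @ elems (a ! 1))] ! f) xs"

text \<open>Equality is charged to its second argument alone, as the comparison descends both trees
  together. Searching a list therefore costs time linear in the weight of the list, whatever is
  searched for.\<close>

definition time :: "nat \<Rightarrow> val list \<Rightarrow> nat" where
  "time f xs = (
    [\<lambda>_. 0,
     \<lambda>a. 25 * size (a ! 1) + 10,
     \<lambda>a. 40 * wt (a ! 1),
     \<lambda>a. 50 * wt (a ! 1),
     \<lambda>a. 60 * (wt (a ! 0) * wt (a ! 1)),
     \<lambda>a. 20 * wt (a ! 1),
     \<lambda>a. 40 * (wt (a ! 0) * wt (a ! 1)),
     \<lambda>a. 40 * (4 * wt (a ! 2)) ^ Suc (depth (a ! 0) (a ! 1)),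
     \<lambda>a. 100 * wt (a ! 1) + 500 * (wt (a ! 0) * wt (a ! 0)),
     \<lambda>a. 600 * (wt (a ! 0) * (wt (a ! 1) + wt (a ! 0))),
     \<lambda>a. 100 * (wt (a ! 2) + wt (a ! 3) + wt (a ! 4) + wt (a ! 5)),
     \<lambda>a. 200 * (wt (a ! 1) * (wt (a ! 0) + wt (a ! 2) + wt (a ! 3) + wt (a ! 4))),
     \<lambda>a. 300 * (wt (a ! 0) * (wt (a ! 1) * (wt (a ! 0) + wt (a ! 2) + wt (a ! 3) + wt (a ! 4)))),
     \<lambda>a. 400 * (wt (a ! 0) * (wt (a ! 2) * (wt (a ! 1) * (2 * wt (a ! 2) + wt (a ! 3) + wt (a ! 4))))),
     \<lambda>a. 20 * wt (a ! 0)] ! f) xs"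

lemma result_simps [simp]:
  "result (Suc 0) [x, y] = truth (x = y)"
  "result 2 [x, y] = truth (x \<in> set (elems y))"
  "result 3 [x, y] = truth (x \<in> left ` set (elems y))"
  "result 4 [x, y] = truth (set (elems x) \<subseteq> set (elems y))"
  "result 5 [x, y, z] = mk (map (Pair x) (elems y) @ elems z)"
  "result 6 [x, y] = val_product x y"
  "result 7 [x, y, z] = val_words x y z"
  "result 8 [x, y] = truth (legal_val y x)"
  "result 9 [x, y] = mk (filter (legal_val y) (elems x))"
  "result 10 [x, y, z, u, v, w] = truth (safe_val x y z u v w)"
  "result 11 [x, y, z, u, v] = truth (good_val y u v (elems z) x)"
  "result 12 [x, y, z, u, v] = mk (filter (good_val y u v (elems z)) (elems x))"
  "result 13 [x, y, z, u, v] = mk (shrink (good_val y u v) (length (elems x)) (elems z))"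
  "result 14 [x, y] = mk (elems x @ elems y)"
  by (simp_all add: result_def)

lemma time_simps [simp]:
  "time (Suc 0) [x, y] = 25 * size y + 10"
  "time 2 [x, y] = 40 * wt y"
  "time 3 [x, y] = 50 * wt y"
  "time 4 [x, y] = 60 * (wt x * wt y)"
  "time 5 [x, y, z] = 20 * wt y"
  "time 6 [x, y] = 40 * (wt x * wt y)"
  "time 7 [x, y, z] = 40 * (4 * wt z) ^ Suc (depth x y)"
  "time 8 [x, y] = 100 * wt y + 500 * (wt x * wt x)"
  "time 9 [x, y] = 600 * (wt x * (wt y + wt x))"
  "time 10 [x, y, z, u, v, w] = 100 * (wt z + wt u + wt v + wt w)"
  "time 11 [x, y, z, u, v] = 200 * (wt y * (wt x + wt z + wt u + wt v))"
  "time 12 [x, y, z, u, v] = 300 * (wt x * (wt y * (wt x + wt z + wt u + wt v)))"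
  "time 13 [x, y, z, u, v] = 400 * (wt x * (wt z * (wt y * (2 * wt z + wt u + wt v))))"
  "time 14 [x, y] = 20 * wt x"
  by (simp_all add: time_def)

lemma wf_solver:
  "f < length solver_arities \<Longrightarrow> wf_expr solver_arities (solver_arities ! f) (solver ! f)"
  by (auto simp: solver_arities_def solver_defs main_body_def less_Suc_eq numeral_eq_Suc)

text \<open>Recursive calls in the body are read off \<open>result\<close> and \<open>time\<close>,
  so each instance needs one unfolding and a case distinction, no induction.\<close>

definition meets_spec :: "nat \<Rightarrow> val list \<Rightarrow> bool" where
  "meets_spec f xs \<longleftrightarrow> meaning result xs (solver ! f) = result f xs \<and>
     cost result time xs (solver ! f) \<le> time f xs"

lemma eq_meets_spec: "meets_spec 1 [x, y]"
  by (cases x; cases y) (auto simp: meets_spec_def solver_defs)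

lemma member_meets_spec: "meets_spec 2 [x, y]"
  by (cases y) (auto simp: meets_spec_def solver_defs wt_eq)

lemma has_key_meets_spec: "meets_spec 3 [x, Y]"
proof (cases Y)
  case (Pair e y)
  then show ?thesis by (cases e) (auto simp: meets_spec_def solver_defs wt_eq)
qed (auto simp: meets_spec_def solver_defs)

lemma subset_meets_spec: "meets_spec 4 [x, y]"
  by (cases x) (auto simp: meets_spec_def solver_defs wt_eq algebra_simps)

lemma pair_with_meets_spec: "meets_spec 5 [x, y, z]"
  using wt_pos[of "left y"] by (cases y) (auto simp: meets_spec_def solver_defs)

lemma product_meets_spec: "meets_spec 6 [x, y]"
proof -
  have "(\<lambda>(x, y). Pair x y) \<circ> Product_Type.Pair a = Pair a" for a
    by auto
  then show ?thesis
    by (cases x) (auto simp: meets_spec_def solver_defs val_product_def wt_eq algebra_simps)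
qed

lemma wt_mk_append: "wt (mk (xs @ ys)) + 1 = wt (mk xs) + wt (mk ys)"
  by (simp add: wt_enc_list)

lemma wt_mk_map_Pair: "wt (mk (map (Pair a) ys)) = length ys * wt a + wt (mk ys)"
  by (induction ys) (auto simp: algebra_simps)

lemma length_elems: "length (elems x) < wt x"
  by (induction x) (auto simp: wt_eq)

text \<open>Each entry \<open>a\<close> of \<open>X\<close> contributes a copy of \<open>Y\<close>
  with \<open>a\<close> attached to every entry, of weight at most twice \<open>wt Y * wt a\<close>.
  The \<open>+ 1\<close> pays for the empty word that \<open>val_words\<close> puts in
  front.\<close>

lemma wt_val_product: "wt (val_product X Y) + 1 \<le> 2 * (wt X * wt Y)"
proof (induction X)
  case Leaf
  then show ?case using wt_pos[of Y] by (simp add: val_product_def)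
next
  case (Pair a X)
  have "(\<lambda>(x, y). Pair x y) \<circ> Product_Type.Pair a = Pair a"
    by auto
  then have "val_product (Pair a X) Y = mk (map (Pair a) (elems Y) @ elems (val_product X Y))"
    by (simp add: val_product_def)
  then have eq: "wt (val_product (Pair a X) Y) + 1 =
      length (elems Y) * wt a + wt Y + wt (val_product X Y)"
    by (simp only: wt_mk_append wt_mk_map_Pair mk_elems)
  have "length (elems Y) * wt a \<le> wt Y * wt a"
    using length_elems[of Y] by (intro mult_le_mono) auto
  moreover have "wt Y * 1 \<le> wt Y * wt a"
    using wt_pos[of a] by (intro mult_le_mono) auto
  moreover have "2 * (wt (Pair a X) * wt Y) = 2 * (wt X * wt Y) + 2 * (wt Y * wt a)"
    by (simp add: algebra_simps)
  ultimately show ?case using Pair.IH(2) unfolding eq by linarith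
qed

lemma wt_val_words: "wt (val_words m w V) \<le> 2 * (2 * wt V) ^ depth m w"
proof (induction m w V rule: val_words.induct)
  case (1 a m b w V)
  have "wt (val_words (Pair a m) (Pair b w) V) \<le> 2 * (wt V * wt (val_words m w V))"
    using wt_val_product[of V "val_words m w V"] by simp
  also have "\<dots> \<le> 2 * (wt V * (2 * (2 * wt V) ^ depth m w))"
    using 1 by (intro mult_le_mono) auto
  finally show ?case by simp
qed auto

lemma words_meets_spec: "meets_spec 7 [m, w, V]"
proof (cases "m = Leaf \<or> w = Leaf")
  case True
  then show ?thesis
    using wt_pos[of V] by (cases m; cases w) (auto simp: meets_spec_def solver_defs)
next
  case False
  then obtain a m' b w' where [simp]: "m = Pair a m'" "w = Pair b w'"
    by (metis val.exhaust)
  \<comment> \<open>The base \<open>4 * wt V\<close>, against \<open>2 * wt V\<close> in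
    \<open>wt_val_words\<close>, leaves room at each level for the cost of forming the
    product.\<close>
  define q where "q = (4 * wt V) ^ depth m' w'"
  have v: "1 \<le> wt V" using wt_pos[of V] by simp
  have "(2 * wt V) ^ depth m' w' \<le> q" unfolding q_def by (intro power_mono) auto
  then have "wt V * wt (val_words m' w' V) \<le> wt V * (2 * q)"
    using wt_val_words[of m' w' V] by (intro mult_le_mono) auto
  moreover have "1 * q \<le> wt V * q" "1 * (wt V * q) \<le> wt V * (wt V * q)" "1 \<le> q"
    using v by (auto simp: q_def intro: mult_le_mono)
  moreover have "time 7 [m', w', V] = 160 * (wt V * q)"
    "time 7 [m, w, V] = 640 * (wt V * (wt V * q))"
    by (simp_all add: q_def)
  moreover have "cost result time [m, w, V] (solver ! 7) \<le>
      20 + 40 * (wt V * wt (val_words m' w' V)) + time 7 [m', w', V]"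
    by (simp add: solver_defs del: time_simps(7))
  ultimately have "cost result time [m, w, V] (solver ! 7) \<le> time 7 [m, w, V]"
    by linarith
  then show ?thesis by (simp add: meets_spec_def solver_defs)
qed

lemma wt_left: "wt (left x) \<le> wt x" and wt_right: "wt (right x) \<le> wt x"
  by (cases x; simp)+

lemma legal_meets_spec: "meets_spec 8 [e, EB]"
proof -
  let ?b = "left (right (left e))" and ?L = "right (right (left e))"
  let ?b' = "left (right e)" and ?L' = "right (right e)"
  have le: "wt ?b \<le> wt e" "wt ?L \<le> wt e" "wt ?b' \<le> wt e" "wt ?L' \<le> wt e"
    by (meson wt_left wt_right order_trans)+
  have "wt ?L * wt ?L' \<le> wt e * wt e" "wt ?L' * (wt ?b + (wt ?b' + wt ?L)) \<le> wt e * (3 * wt e)"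
    "wt e * 1 \<le> wt e * wt e"
    using le wt_pos[of e] by (intro mult_le_mono; simp)+
  moreover have "cost result time [e, EB] (solver ! 8) \<le> 60 + 40 * wt EB + 60 * (wt ?L * wt ?L') +
      60 * (wt ?L' * (wt ?b + (wt ?b' + wt ?L))) + 40 * wt ?L' + 40 * wt ?L"
    by (simp add: solver_defs)
  moreover have "0 < wt e" "0 < wt EB" by (simp_all add: wt_pos)
  ultimately have "cost result time [e, EB] (solver ! 8) \<le> time 8 [e, EB]"
    using le unfolding time_simps by linarith
  then show ?thesis by (simp add: meets_spec_def solver_defs legal_val_def Let_def)
qed

lemma filter_legal_meets_spec: "meets_spec 9 [x, y]"
  by (cases x) (auto simp: meets_spec_def solver_defs wt_eq algebra_simps)

lemma safe_meets_spec: "meets_spec 10 [x, y, z, u, v, w]"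
  by (auto simp: meets_spec_def solver_defs wt_eq algebra_simps safe_val_def)

lemma filter_good_meets_spec: "meets_spec 12 [x, y, z, u, v]"
  by (cases x) (auto simp: meets_spec_def solver_defs wt_eq algebra_simps)

lemma append_meets_spec: "meets_spec 14 [x, y]"
  by (cases x) (auto simp: meets_spec_def solver_defs wt_eq algebra_simps)


lemma good_meets_spec: "meets_spec 11 [e, y, z, u, v]"
proof -
  \<comment> \<open>The first tree is the second argument of the equality test, the second is the
    list of marks handed to \<open>call_safe\<close>.\<close>
  have "size (left (left e)) \<le> size e" "size (right (right e)) \<le> size e"
    using wt_left[of e] wt_left[of "left e"] wt_right[of e] wt_right[of "right e"]
    by (simp_all add: wt_eq)
  then show ?thesis
    by (cases y) (auto simp: meets_spec_def solver_defs good_val_def wt_eq algebra_simps)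
qed

lemma wt_mk_filter: "wt (mk (filter P xs)) \<le> wt (mk xs)"
  by (induction xs) auto

lemma shrink_meets_spec: "meets_spec 13 [x, y, z, u, v]"
proof (cases x)
  case Leaf
  then show ?thesis using wt_pos[of y] wt_pos[of z] wt_pos[of u]
    by (auto simp: meets_spec_def solver_defs wt_eq)
next
  case (Pair a b)
  let ?z = "mk (filter (good_val y u v (elems z)) (elems z))"
  \<comment> \<open>One round costs 300 * \<open>M\<close>, where \<open>2 * wt z\<close> arises
    because \<open>z\<close> is both filtered and searched. Filtering never increases the weight, so
    \<open>M\<close> bounds the later rounds too, and \<open>wt a\<close> in \<open>wt x\<close>
    pays for the present one.\<close>
  define M where "M = wt z * (wt y * (2 * wt z + wt u + wt v))"
  have "wt ?z * (wt y * (2 * wt ?z + wt u + wt v)) \<le> M"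
    unfolding M_def using wt_mk_filter[of "good_val y u v (elems z)" "elems z"]
    by (intro mult_le_mono add_mono) auto
  then have "wt b * (wt ?z * (wt y * (2 * wt ?z + wt u + wt v))) \<le> wt b * M"
    by simp
  moreover have "1 \<le> M" using wt_pos[of y] wt_pos[of z] wt_pos[of u]
    by (simp add: M_def Suc_le_eq)
  moreover have "1 * M \<le> wt a * M" using wt_pos[of a] by (intro mult_le_mono) auto
  moreover have "time 12 [z, y, z, u, v] = 300 * M"
    "time 13 [x, y, z, u, v] = 400 * (wt a * M) + 400 * (wt b * M)"
    by (simp_all add: Pair M_def algebra_simps)
  moreover have "cost result time [x, y, z, u, v] (solver ! 13) \<le>
      20 + time 12 [z, y, z, u, v] + 400 * (wt b * (wt ?z * (wt y * (2 * wt ?z + wt u + wt v))))"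
    by (simp add: Pair solver_defs del: time_simps(12))
  ultimately have "cost result time [x, y, z, u, v] (solver ! 13) \<le> time 13 [x, y, z, u, v]"
    by linarith
  then show ?thesis by (simp add: Pair meets_spec_def solver_defs)
qed

lemma solver_meets_spec:
  assumes "0 < f" "f < length solver_arities" "length xs = solver_arities ! f"
  shows "meets_spec f xs"
  using assms eq_meets_spec member_meets_spec has_key_meets_spec subset_meets_spec
    pair_with_meets_spec product_meets_spec
    words_meets_spec legal_meets_spec filter_legal_meets_spec safe_meets_spec good_meets_spec
    filter_good_meets_spec shrink_meets_spec append_meets_spec
  by (auto simp: solver_arities_def less_Suc_eq numeral_eq_Suc length_Suc_conv)

lemma solver_eval:
  "\<exists>s\<le>cost result time [x] main_body.
     eval solver [x] main_body (meaning result [x] main_body) s"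
proof (rule eval_if_meaning_cost[where ar = solver_arities])
  show "length solver = length solver_arities" by (simp add: solver_def solver_arities_def)
next
  show "wf_expr solver_arities (length [x]) main_body"
    using wf_solver[of 0] by (simp add: solver_arities_def solver_def)
qed (use wf_solver solver_meets_spec in \<open>auto simp: meets_spec_def\<close>)

section \<open>Result and cost of the main program\<close>

lemma meaning_rights: "meaning F env ((ERight ^^ k) e) = (right ^^ k) (meaning F env e)"
  by (induction k) auto

lemma cost_rights: "cost F T env ((ERight ^^ k) e) = cost F T env e + k"
  by (induction k) auto

lemma left_rights_mk: "k < length xs \<Longrightarrow> left ((right ^^ k) (mk xs)) = xs ! k"
proof (induction k arbitrary: xs)
  case 0
  then show ?case by (cases xs) auto
next
  case (Suc k)
  then show ?case by (cases xs) (auto simp: funpow_swap1)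
qed

definition val_transitions :: "val \<Rightarrow> val \<Rightarrow> val \<Rightarrow> val list" where
  "val_transitions V EB W = filter (legal_val EB)
     (elems (val_product (val_product V (val_product V W)) (val_product V W)))"

lemma left_mk: "left (mk (x # xs)) = x" and right_mk: "right (mk (x # xs)) = mk xs"
  by simp_all

lemma main_result:
  fixes V ET EB tT tB m O' Fin
  defines "x \<equiv> mk [V, ET, EB, tT, tB, Pair Leaf m, O', Fin]"
    and "E \<equiv> val_transitions V EB (val_words m V V)"
  shows "meaning result [x] main_body =
    mk (shrink (good_val ET EB Fin) (length E) E @ E)"
  unfolding main_body_def x_def E_def val_transitions_def
  by (simp add: meaning_rights left_rights_mk left_mk right_mk del: enc_list_simps)

lemma wt_mk_shrink: "wt (mk (shrink g k Z)) \<le> wt (mk Z)"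
proof (induction k arbitrary: Z)
  case (Suc k)
  show ?case using Suc.IH[of "filter (g Z) Z"] wt_mk_filter[of "g Z" Z]
    unfolding id_def by simp
qed simp

text \<open>The iteration dominates: 400 * 8704, with 8704 = 16 * 16 * (2 * 16 + 1 + 1), stays below
  4000000 with room for all other terms.\<close>

lemma main_cost:
  fixes V ET EB tT tB m O' Fin
  defines "x \<equiv> mk [V, ET, EB, tT, tB, Pair Leaf m, O', Fin]"
    and "E \<equiv> val_transitions V EB (val_words m V V)"
  assumes "wt V \<le> K" "wt ET \<le> K" "wt EB \<le> K" "wt Fin \<le> K"
    "wt (val_words m V V) \<le> K" "(4 * wt V) ^ Suc (depth m V) \<le> K"
  shows "cost result time [x] main_body + size (meaning result [x] main_body) \<le> 4000000 * K ^ 16"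
proof -
  let ?W = "val_words m V V"
  let ?A = "val_product V ?W" and ?B = "val_product V (val_product V ?W)"
  let ?C = "val_product ?B ?A"
  have K: "1 \<le> K" using assms(3) wt_pos[of V] by linarith
  have pow: "K ^ i \<le> K ^ 16" if "i \<le> 16" for i
    using K that by (intro power_increasing) auto
  have A: "wt ?A \<le> 2 * K ^ 2"
  proof -
    have "wt ?A \<le> 2 * (wt V * wt ?W)" using wt_val_product[of V ?W] by simp
    also have "\<dots> \<le> 2 * (K * K)" using assms by (intro mult_le_mono) auto
    finally show ?thesis by (simp add: power2_eq_square)
  qed
  have B: "wt ?B \<le> 4 * K ^ 3"
  proof -
    have "wt ?B \<le> 2 * (wt V * wt ?A)" using wt_val_product[of V ?A] by simp
    also have "\<dots> \<le> 2 * (K * (2 * K ^ 2))" using assms A by (intro mult_le_mono) auto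
    finally show ?thesis by (simp add: power2_eq_square power3_eq_cube)
  qed
  have BA: "wt ?B * wt ?A \<le> 8 * K ^ 5"
  proof -
    have "wt ?B * wt ?A \<le> (4 * K ^ 3) * (2 * K ^ 2)" using A B by (intro mult_le_mono) auto
    then show ?thesis by (simp flip: power_add)
  qed
  have C: "wt ?C \<le> 16 * K ^ 5"
    using wt_val_product[of ?B ?A] BA by simp
  have E: "wt (mk E) \<le> 16 * K ^ 5"
    unfolding E_def val_transitions_def using wt_mk_filter[of "legal_val EB" "elems ?C"] C by simp
  have K5: "K \<le> K ^ 5" using power_increasing[of 1 5 K] K by simp
  have VW: "wt V * wt ?W \<le> K ^ 16"
  proof -
    have "wt V * wt ?W \<le> K * K" using assms by (intro mult_le_mono) auto
    then show ?thesis using pow[of 2] by (simp add: power2_eq_square)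
  qed
  have VA: "wt V * wt ?A \<le> 2 * K ^ 16"
  proof -
    have "wt V * wt ?A \<le> K * (2 * K ^ 2)" using assms A by (intro mult_le_mono) auto
    then show ?thesis using pow[of 3] by (simp add: power2_eq_square power3_eq_cube)
  qed
  have FL: "wt ?C * (wt EB + wt ?C) \<le> 272 * K ^ 16"
  proof -
    have "wt ?C * (wt EB + wt ?C) \<le> (16 * K ^ 5) * (K ^ 5 + 16 * K ^ 5)"
      using assms C K5 by (intro mult_le_mono add_mono) auto
    also have "\<dots> = 272 * K ^ 10" by (simp flip: power_add)
    finally show ?thesis using pow[of 10] by simp
  qed
  have SH: "wt (mk E) * (wt (mk E) * (wt ET * (2 * wt (mk E) + wt EB + wt Fin))) \<le> 8704 * K ^ 16"
  proof -
    have "wt (mk E) * (wt (mk E) * (wt ET * (2 * wt (mk E) + wt EB + wt Fin)))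
      \<le> (16 * K ^ 5) * ((16 * K ^ 5) * (K * (2 * (16 * K ^ 5) + K ^ 5 + K ^ 5)))"
      using assms E K5 by (intro mult_le_mono add_mono) auto
    also have "\<dots> = 8704 * K ^ 16" by (simp flip: power_add power_Suc)
    finally show ?thesis .
  qed
  let ?R = "shrink (good_val ET EB Fin) (length E) E"
  have R: "wt (mk ?R) \<le> wt (mk E)" by (rule wt_mk_shrink)
  have sz: "size (meaning result [x] main_body) \<le> 32 * K ^ 16"
    using wt_mk_append[of ?R E] R E pow[of 5] main_result[of V ET EB tT tB m O' Fin]
    by (simp add: x_def E_def wt_eq)
  have cst: "cost result time [x] main_body \<le> 200 + 40 * (4 * wt V) ^ Suc (depth m V) +
      40 * (2 * (wt V * wt ?W) + wt V * wt ?A + wt ?B * wt ?A) + 600 * (wt ?C * (wt EB + wt ?C)) +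
      400 * (wt (mk E) * (wt (mk E) * (wt ET * (2 * wt (mk E) + wt EB + wt Fin)))) +
      20 * wt (mk ?R)"
    unfolding main_body_def x_def E_def val_transitions_def
    by (simp add: meaning_rights cost_rights left_rights_mk left_mk right_mk del: enc_list_simps)
  \<comment> \<open>With sizes and powers of \<open>K\<close> replaced by variables, the final
    estimate is linear.\<close>
  have arith: "c + z \<le> 4000000 * q"
    if "c \<le> 200 + 40 * a + 40 * (2 * b + d + e) + 600 * f + 400 * g + 20 * h"
      "z \<le> 32 * q" "a \<le> K" "b \<le> q" "d \<le> 2 * q" "e \<le> 8 * p" "f \<le> 272 * q" "g \<le> 8704 * q"
      "h \<le> r" "r \<le> 16 * p" "p \<le> q" "K \<le> q" "1 \<le> q" for a b c d e f g h p q r z :: nat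
    using that by simp
  have "K \<le> K ^ 16" "1 \<le> K ^ 16" "K ^ 5 \<le> K ^ 16" using pow[of 1] pow[of 5] K by auto
  then show ?thesis
    by (intro arith[OF cst sz assms(8) VW VA BA FL SH R E])
qed

section \<open>Encodings\<close>

lemma enc_nat_inject [simp]: "enc_nat i = enc_nat j \<longleftrightarrow> i = j"
proof (induction i arbitrary: j)
  case 0
  then show ?case by (cases j) auto
next
  case (Suc i)
  then show ?case by (cases j) auto
qed

lemma nth_length_takeWhile_neq: "v \<in> set vs \<Longrightarrow> vs ! length (takeWhile (\<lambda>x. x \<noteq> v) vs) = v"
  by (induction vs) auto

lemma enc_vertex_inject:
  "u \<in> set vs \<Longrightarrow> v \<in> set vs \<Longrightarrow> enc_vertex vs u = enc_vertex vs v \<longleftrightarrow> u = v"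
  unfolding enc_vertex_def by (metis enc_nat_inject nth_length_takeWhile_neq)

lemma enc_vertex_image_iff:
  "v \<in> set vs \<Longrightarrow> A \<subseteq> set vs \<Longrightarrow> enc_vertex vs v \<in> enc_vertex vs ` A \<longleftrightarrow> v \<in> A"
  using enc_vertex_inject by fastforce

lemma enc_vertices_inject:
  assumes "set L \<subseteq> set vs" "set L' \<subseteq> set vs"
  shows "enc_vertices vs L = enc_vertices vs L' \<longleftrightarrow> L = L'"
proof
  assume "enc_vertices vs L = enc_vertices vs L'"
  then have "map (enc_vertex vs) L = map (enc_vertex vs) L'"
    unfolding enc_vertices_def by (metis elems_enc_list)
  moreover have "inj_on (enc_vertex vs) (set L \<union> set L')"
    using assms enc_vertex_inject[of _ vs] by (intro inj_onI) blast
  ultimately show "L = L'" by (metis map_inj_on)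
qed simp

lemma elems_enc_vertices: "elems (enc_vertices vs L) = map (enc_vertex vs) L"
  by (simp add: enc_vertices_def)

lemma set_elems_enc_edges:
  "E \<subseteq> set vs \<times> set vs \<Longrightarrow>
    set (elems (enc_edges vs E)) = (\<lambda>(u, v). Pair (enc_vertex vs u) (enc_vertex vs v)) ` E"
  by (auto simp: enc_edges_def)

lemma val_product_enc_list:
  "val_product (enc_list f xs) (enc_list g ys) =
     enc_list (\<lambda>(x, y). Pair (f x) (g y)) (List.product xs ys)"
proof -
  have "map (\<lambda>(x, y). Pair x y) (List.product (map f xs) (map g ys)) =
      map (\<lambda>(x, y). Pair (f x) (g y)) (List.product xs ys)"
    by (induction xs) (auto simp: comp_def)
  then show ?thesis by (simp add: val_product_def mk_map)
qed

lemma enc_list_map: "enc_list f (map g xs) = enc_list (f \<circ> g) xs"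
  by (induction xs) auto

text \<open>The counter \<open>ws\<close> is kept apart from the alphabet \<open>vs\<close> because
  only the counter shrinks in the recursion.\<close>

lemma val_words_enc:
  "val_words (enc_nat m) (enc_list g ws) (enc_list f vs) =
     enc_list (enc_list f) (words vs (min m (length ws)))"
proof (induction m arbitrary: ws)
  case (Suc m)
  have "enc_list f \<circ> (\<lambda>(v, L). v # L) = (\<lambda>(v, L). Pair (f v) (enc_list f L))"
    by auto
  then show ?case using Suc by (cases ws) (auto simp: val_product_enc_list enc_list_map)
qed simp

lemma depth_enc: "depth (enc_nat m) (enc_list g ws) = min m (length ws)"
proof (induction m arbitrary: ws)
  case (Suc m)
  then show ?case by (cases ws) auto
qed simp

definition enc_transition :: "'v list \<Rightarrow> 'v transition \<Rightarrow> val" where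
  "enc_transition vs = (\<lambda>((t, b, L), (b', L')).
     Pair (Pair (enc_vertex vs t) (Pair (enc_vertex vs b) (enc_vertices vs L)))
          (Pair (enc_vertex vs b') (enc_vertices vs L')))"

lemma enc_table_eq: "enc_table vs tbl = mk (map (enc_transition vs) tbl)"
  by (simp add: enc_table_def enc_transition_def mk_map)

text \<open>An equality of lists, order included: the output has to be the encoding of one
  particular table. The nesting of products in \<open>candidates\<close> copies that in
  \<open>main_body\<close>.\<close>

lemma elems_candidates:
  fixes vs :: "'v list" and k :: nat
  defines "V \<equiv> enc_vertices vs vs" and "W \<equiv> enc_list (enc_vertices vs) (words vs k)"
  shows "elems (val_product (val_product V (val_product V W)) (val_product V W)) =
    map (enc_transition vs) (candidates vs k)"
proof -
  have "enc_transition vs = (\<lambda>(x, y). Pair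
      (case x of (x, y) \<Rightarrow> Pair (enc_vertex vs x)
        (case y of (x, y) \<Rightarrow> Pair (enc_vertex vs x) (enc_vertices vs y)))
      (case y of (x, y) \<Rightarrow> Pair (enc_vertex vs x) (enc_vertices vs y)))"
    by (auto simp: enc_transition_def fun_eq_iff)
  then show ?thesis
    unfolding V_def W_def enc_vertices_def[of vs] candidates_def
    by (simp add: val_product_enc_list enc_vertices_def)
qed

lemma enc_vertices_image_subset:
  assumes "A \<subseteq> set vs" "B \<subseteq> set vs"
  shows "enc_vertex vs ` A \<subseteq> enc_vertex vs ` B \<longleftrightarrow> A \<subseteq> B"
  using enc_vertex_image_iff[OF _ assms(2)] assms(1) by blast

lemma legal_val_enc:
  assumes "e \<in> set (candidates vs k)" "EB \<subseteq> set vs \<times> set vs"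
  shows "legal_val (enc_edges vs EB) (enc_transition vs e) \<longleftrightarrow> legal EB e"
proof -
  obtain t b L b' L' where e: "e = ((t, b, L), (b', L'))" by (metis prod.exhaust)
  with assms have v: "t \<in> set vs" "b \<in> set vs" "b' \<in> set vs" "set L \<subseteq> set vs" "set L' \<subseteq> set vs"
    by (auto simp: candidates_def set_words)
  have "Pair (enc_vertex vs b) (enc_vertex vs b') \<in> set (elems (enc_edges vs EB)) \<longleftrightarrow> (b, b') \<in> EB"
    (is "?l \<longleftrightarrow> ?r")
  proof
    assume ?l
    then obtain u w where "(u, w) \<in> EB" "enc_vertex vs b = enc_vertex vs u"
      "enc_vertex vs b' = enc_vertex vs w"
      unfolding set_elems_enc_edges[OF assms(2)] by auto
    moreover from this have "u \<in> set vs" "w \<in> set vs" using assms(2) by auto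
    ultimately show ?r using v by (simp add: enc_vertex_inject)
  next
    assume ?r
    then show ?l unfolding set_elems_enc_edges[OF assms(2)] by (intro image_eqI[of _ _ "(b, b')"]) auto
  qed
  moreover have "enc_vertex vs ` set L' \<subseteq>
        insert (enc_vertex vs b) (insert (enc_vertex vs b') (enc_vertex vs ` set L))
      \<longleftrightarrow> set L' \<subseteq> insert b (insert b' (set L))"
    using enc_vertices_image_subset[of "set L'" vs "insert b (insert b' (set L))"] v by simp
  ultimately show ?thesis
    using v by (simp add: e legal_val_def legal_def enc_transition_def elems_enc_vertices
        enc_vertex_image_iff enc_vertices_image_subset)
qed

lemma good_val_enc:
  assumes Z: "set Z \<subseteq> set (candidates vs k)" and e: "e \<in> set (candidates vs k)"
    and E: "ET \<subseteq> set vs \<times> set vs" "EB \<subseteq> set vs \<times> set vs" and Fin: "Fin \<subseteq> set vs"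
  shows "good_val (enc_edges vs ET) (enc_edges vs EB) (enc_set vs Fin)
      (map (enc_transition vs) Z) (enc_transition vs e) \<longleftrightarrow> good ET EB Fin Z e"
proof -
  obtain t b L b' L' where e_eq: "e = ((t, b, L), (b', L'))" by (metis prod.exhaust)
  with e have v: "t \<in> set vs" "b' \<in> set vs" "set L' \<subseteq> set vs"
    by (auto simp: candidates_def set_words)
  have fin: "set (elems (enc_set vs Fin)) = enc_vertex vs ` Fin"
    using Fin by (auto simp: enc_set_def elems_enc_vertices)
  have dom: "enc_vertex vs b' \<in> left ` set (elems (enc_edges vs EB)) \<longleftrightarrow> b' \<in> Domain EB"
  proof -
    have "left ` set (elems (enc_edges vs EB)) = enc_vertex vs ` Domain EB"
      unfolding set_elems_enc_edges[OF E(2)] by force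
    moreover have "Domain EB \<subseteq> set vs" using E(2) by blast
    ultimately show ?thesis using enc_vertex_image_iff v(2) by metis
  qed
  \<comment> \<open>Keys are compared as trees, hence as lists of marks and not as sets;
    \<open>enc_vertices\<close> is injective on lists over \<open>vs\<close>.\<close>
  have key: "Pair (enc_vertex vs u) (Pair (enc_vertex vs b') (enc_vertices vs L')) \<in>
      left ` enc_transition vs ` set Z \<longleftrightarrow> (u, b', L') \<in> Domain (set Z)"
    (is "?l \<longleftrightarrow> ?r") if u: "u \<in> set vs" for u
  proof
    assume ?l
    then obtain t1 b1 L1 mv where z: "((t1, b1, L1), mv) \<in> set Z"
      "enc_vertex vs u = enc_vertex vs t1" "enc_vertex vs b' = enc_vertex vs b1"
      "enc_vertices vs L' = enc_vertices vs L1"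
      by (auto simp: enc_transition_def)
    then have "t1 \<in> set vs" "b1 \<in> set vs" "set L1 \<subseteq> set vs"
      using Z by (auto simp: candidates_def set_words)
    with z u v show ?r by (auto simp: enc_vertex_inject enc_vertices_inject)
  next
    assume ?r
    then show ?l by (force simp: enc_transition_def)
  qed
  have safe: "safe_val (enc_vertex vs u) (enc_vertex vs b') (enc_vertices vs L')
      (mk (map (enc_transition vs) Z)) (enc_edges vs EB) (enc_set vs Fin) \<longleftrightarrow>
      safe EB Fin (set Z) (u, b', L')" if "u \<in> set vs" for u
    using that v Fin key[OF that]
    by (simp add: safe_val_def safe_def fin dom elems_enc_vertices enc_vertex_image_iff image_comp)
  have "good_val (enc_edges vs ET) (enc_edges vs EB) (enc_set vs Fin)
      (map (enc_transition vs) Z) (enc_transition vs e) \<longleftrightarrow>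
    (\<forall>(x, u)\<in>ET. x = t \<longrightarrow> safe EB Fin (set Z) (u, b', L'))"
  proof -
    have "good_val (enc_edges vs ET) (enc_edges vs EB) (enc_set vs Fin)
      (map (enc_transition vs) Z) (enc_transition vs e) \<longleftrightarrow>
      (\<forall>(x, u)\<in>ET. enc_vertex vs x = enc_vertex vs t \<longrightarrow>
        safe_val (enc_vertex vs u) (enc_vertex vs b') (enc_vertices vs L')
          (mk (map (enc_transition vs) Z)) (enc_edges vs EB) (enc_set vs Fin))"
      unfolding good_val_def set_elems_enc_edges[OF E(1)]
      by (simp add: e_eq enc_transition_def[of vs] split_beta)
    also have "\<dots> \<longleftrightarrow> (\<forall>(x, u)\<in>ET. x = t \<longrightarrow> safe EB Fin (set Z) (u, b', L'))"
      using E(1) v(1) by (intro ball_cong refl) (auto simp: enc_vertex_inject safe)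
    finally show ?thesis .
  qed
  then show ?thesis by (auto simp: good_def e_eq)
qed

context finite_budget_game
begin

lemma enc_game_eq:
  "enc_game vs G = mk [enc_vertices vs vs, enc_edges vs (edges_T G), enc_edges vs (edges_B G),
     enc_vertex vs (init_T G), enc_vertex vs (init_B G), Pair Leaf (enc_nat m),
     enc_list (\<lambda>v. enc_set vs (obs G v)) vs, enc_set vs (final G)]"
proof -
  have "filter (\<lambda>v. v \<in> verts G) vs = vs" by (simp add: vs filter_id_conv)
  then show ?thesis by (simp add: enc_game_def enc_set_def budget)
qed

lemma solver_result:
  "meaning result [enc_game vs G] main_body = enc_table vs (stable @ transitions)"
proof -
  have E: "edges_T G \<subseteq> set vs \<times> set vs" "edges_B G \<subseteq> set vs \<times> set vs" "final G \<subseteq> set vs"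
    using valid by (auto simp: valid_game_def vs)
  have W: "val_words (enc_nat m) (enc_vertices vs vs) (enc_vertices vs vs) =
      enc_list (enc_vertices vs) (words vs max_marks)"
    unfolding enc_vertices_def val_words_enc max_marks_def ..
  have tr: "val_transitions (enc_vertices vs vs) (enc_edges vs (edges_B G))
      (enc_list (enc_vertices vs) (words vs max_marks)) = map (enc_transition vs) transitions"
    unfolding val_transitions_def elems_candidates filter_map transitions_def
    using legal_val_enc[OF _ E(2)] by (intro arg_cong[where f = "map _"] filter_cong) auto
  have sub: "set transitions \<subseteq> set (candidates vs max_marks)" by (auto simp: transitions_def)
  have "shrink (good_val (enc_edges vs (edges_T G)) (enc_edges vs (edges_B G)) (enc_set vs (final G)))
      (length transitions) (map (enc_transition vs) transitions) = map (enc_transition vs) stable"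
    unfolding stable_def
    by (rule shrink_map[OF sub], rule good_val_enc[where k = max_marks, OF _ _ E]) auto
  then show ?thesis
    unfolding enc_game_eq main_result W tr by (simp add: enc_table_eq)
qed

end

section \<open>Weight of the encoded game and the bound in n and m\<close>

lemma wt_enc_vertex: "v \<in> set vs \<Longrightarrow> wt (enc_vertex vs v) \<le> length vs"
proof -
  have "wt (enc_nat i) = Suc i" for i
    by (induction i) auto
  moreover have "v \<in> set vs \<Longrightarrow> length (takeWhile (\<lambda>x. x \<noteq> v) vs) < length vs"
    by (induction vs) auto
  ultimately show "v \<in> set vs \<Longrightarrow> ?thesis" by (simp add: enc_vertex_def Suc_le_eq)
qed

lemma wt_enc_list_le:
  "(\<And>x. x \<in> set xs \<Longrightarrow> wt (f x) \<le> B) \<Longrightarrow> wt (enc_list f xs) \<le> length xs * B + 1"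
  by (induction xs) (force simp: add.assoc intro: add_mono)+

lemma wt_enc_set: "wt (enc_set vs S) \<le> length vs * length vs + 1"
proof -
  have "wt (enc_set vs S) \<le> length (filter (\<lambda>v. v \<in> S) vs) * length vs + 1"
    unfolding enc_set_def enc_vertices_def by (intro wt_enc_list_le) (auto simp: wt_enc_vertex)
  also have "\<dots> \<le> length vs * length vs + 1"
    by (simp add: mult_le_mono)
  finally show ?thesis .
qed

lemma wt_enc_edges: "wt (enc_edges vs E) \<le> 2 * length vs ^ 3 + 1"
proof -
  let ?es = "filter (\<lambda>e. e \<in> E) (List.product vs vs)"
  have "wt (Pair (enc_vertex vs u) (enc_vertex vs v)) \<le> 2 * length vs"
    if "u \<in> set vs" "v \<in> set vs" for u v
    using wt_enc_vertex[OF that(1)] wt_enc_vertex[OF that(2)] by simp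
  then have "wt (enc_edges vs E) \<le> length ?es * (2 * length vs) + 1"
    unfolding enc_edges_def by (intro wt_enc_list_le) auto
  also have "length ?es \<le> length vs * length vs"
    by (metis length_filter_le length_product)
  then have "length ?es * (2 * length vs) + 1 \<le> length vs * length vs * (2 * length vs) + 1"
    by (intro add_mono mult_le_mono) auto
  finally show ?thesis by (simp add: power3_eq_cube mult.assoc mult.left_commute)
qed

text \<open>For n = 1 no power of n absorbs the factor 8, but the capped exponent is at most 2,
  whence 64. For larger n, 8 is at most n^3, so the base is at most n^6, and m + 1 is at most twice
  \<open>max 1 m\<close>.\<close>

lemma power_min_bound:
  fixes n m :: nat
  assumes "0 < n"
  shows "(8 * n ^ 3) ^ Suc (min m n) \<le> 64 * n ^ (12 * max 1 m)"
proof (cases "n = 1")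
  case True
  have "(8::nat) ^ Suc (min m 1) \<le> 8 ^ 2" by (intro power_increasing) auto
  then show ?thesis using True by simp
next
  case False
  with assms have n: "2 \<le> n" by simp
  have "(2::nat) ^ 3 \<le> n ^ 3" using n by (intro power_mono) auto
  then have "8 * n ^ 3 \<le> n ^ 3 * n ^ 3" by (intro mult_le_mono) simp_all
  then have "(8 * n ^ 3) ^ Suc (min m n) \<le> (n ^ 6) ^ Suc (min m n)"
    by (intro power_mono) (simp_all flip: power_add)
  also have "\<dots> = n ^ (6 * Suc (min m n))" by (simp only: power_mult)
  also have "\<dots> \<le> n ^ (12 * max 1 m)" using assms by (intro power_increasing) auto
  finally show ?thesis by simp
qed

context finite_budget_game
begin

lemma solver_cost:
  "cost result time [enc_game vs G] main_body + size (meaning result [enc_game vs G] main_body) \<le>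
    4000000 * 64 ^ 16 * length vs ^ (192 * max 1 m)"
proof -
  define n where "n = length vs"
  \<comment> \<open>8 * n^3 is 4 times the bound 2 * n^3 on the weight of the vertex list; it also
    exceeds the weight of an encoded edge set.\<close>
  define K where "K = (8 * n ^ 3) ^ Suc (min m n)"
  have "vs \<noteq> []" using valid vs by (auto simp: valid_game_def)
  then have n: "0 < n" by (simp add: n_def)
  have le_K: "8 * n ^ 3 \<le> K"
    unfolding K_def using n by (intro self_le_power) auto
  have n23: "n * n \<le> n ^ 3" "1 \<le> n ^ 3"
    using n by (simp_all add: power3_eq_cube Suc_le_eq)
  have set_le: "wt (enc_set vs S) \<le> 2 * n ^ 3" for S
    using wt_enc_set[of vs S] n23 by (simp add: n_def)
  have edges_le: "wt (enc_edges vs E) \<le> K" for E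
    using wt_enc_edges[of vs E] n23 le_K by (simp add: n_def)
  let ?V = "enc_vertices vs vs"
  have "enc_set vs (set vs) = ?V" by (simp add: enc_set_def)
  then have V: "wt ?V \<le> 2 * n ^ 3" using set_le by metis
  have d: "depth (enc_nat m) ?V = min m n"
    by (simp add: enc_vertices_def depth_enc n_def)
  have "(4 * wt ?V) ^ Suc (depth (enc_nat m) ?V) \<le> K"
    unfolding K_def d using V by (intro power_mono) auto
  moreover have "wt (val_words (enc_nat m) ?V ?V) \<le> K"
  proof -
    have "2 * wt ?V \<le> 8 * n ^ 3" using V by simp
    then have pow: "(2 * wt ?V) ^ min m n \<le> (8 * n ^ 3) ^ min m n" by (rule power_mono) simp
    have "wt (val_words (enc_nat m) ?V ?V) \<le> 2 * (2 * wt ?V) ^ min m n"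
      using wt_val_words[of "enc_nat m" ?V ?V] d by simp
    also have "\<dots> \<le> (8 * n ^ 3) * (8 * n ^ 3) ^ min m n"
      using n23 by (intro mult_le_mono pow) auto
    finally show ?thesis by (simp add: K_def)
  qed
  ultimately have "cost result time [enc_game vs G] main_body +
      size (meaning result [enc_game vs G] main_body) \<le> 4000000 * K ^ 16"
    unfolding enc_game_eq using V set_le[of "final G"] le_K edges_le
    by (intro main_cost) simp_all
  also have "K ^ 16 \<le> (64 * n ^ (12 * max 1 m)) ^ 16"
    unfolding K_def by (intro power_mono power_min_bound n) simp
  also have "\<dots> = 64 ^ 16 * n ^ (192 * max 1 m)"
    unfolding power_mult_distrib by (simp only: power_mult[symmetric]) (simp add: mult.commute)
  finally show ?thesis by (simp add: n_def mult.assoc)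
qed

end

theorem theorem3:
  "\<exists>(P :: prog) (c :: nat). \<forall>(G :: 'v sabotage_game) (m :: nat) (vs :: 'v list).
     valid_game G \<and> budget G = enat m \<and> (\<forall>v\<in>verts G. obs G v = verts G) \<and>
     distinct vs \<and> set vs = verts G \<and>
     (\<exists>\<sigma>. saboteur_winning G \<sigma>) \<longrightarrow>
     (\<exists>tbl t. computes_in_time P (enc_game vs G) (enc_table vs tbl) t \<and>
        t \<le> c * card (verts G) ^ (c * max 1 m) \<and>
        saboteur_winning G (table_strategy tbl))"
proof -
  \<comment> \<open>Obtained as a variable so that the simplifier does not expand the
    numeral.\<close>
  obtain a :: nat where a: "a = 4000000 * 64 ^ 16" by blast
  have main: "\<exists>tbl t. computes_in_time solver (enc_game vs G) (enc_table vs tbl) t \<and>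
      t \<le> (a + 192) * card (verts G) ^ ((a + 192) * max 1 m) \<and>
      saboteur_winning G (table_strategy tbl)"
    if "valid_game G" "budget G = enat m" "distinct vs" "set vs = verts G" "saboteur_winning G \<sigma>"
    for G :: "'v sabotage_game" and m vs \<sigma>
  proof -
    interpret finite_budget_game G m vs
      using that by unfold_locales
    have card: "card (verts G) = length vs"
      using that by (metis distinct_card)
    obtain s where s: "s \<le> cost result time [enc_game vs G] main_body"
      "eval solver [enc_game vs G] main_body (enc_table vs (stable @ transitions)) s"
      using solver_eval[of "enc_game vs G"] by (auto simp: solver_result)
    let ?t = "s + size (enc_table vs (stable @ transitions))"
    have "?t \<le> a * length vs ^ (192 * max 1 m)"
      using s(1) solver_cost by (simp add: solver_result a)
    \<comment> \<open>A single constant has to serve as factor and in the exponent. Raising the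
      exponent requires a vertex to exist, which the initial positions provide.\<close>
    also have "\<dots> \<le> (a + 192) * length vs ^ ((a + 192) * max 1 m)"
    proof (intro mult_le_mono power_increasing)
      have "vs \<noteq> []" using valid vs by (auto simp: valid_game_def)
      then show "1 \<le> length vs" by (simp add: Suc_le_eq)
    qed auto
    finally have "?t \<le> (a + 192) * card (verts G) ^ ((a + 192) * max 1 m)"
      by (simp only: card)
    moreover have "solver \<noteq> []" "solver ! 0 = main_body" by (simp_all add: solver_def)
    then have "computes_in_time solver (enc_game vs G) (enc_table vs (stable @ transitions)) ?t"
      using s(2) by (auto simp: computes_in_time_def)
    ultimately show ?thesis using table_winning[OF that(5)] by blast
  qed
  then show ?thesis by blast
qed

end
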